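(* Suppose that all Hopf bifurcations of (1) are subcritical, i.e. $C>H(m)B^2$ for every $m\in\mathbb Z$, and let $k\ge0$ be an integer. Then for all sufficiently small $\eta>0$, the minimal period of the periodic solution on the $k$th Hopf branch at parameter $\mu_k-\eta$ satisfies $$T^k_\eta\ \le\ \frac{4}{4k+1-\frac{2\eta}{\pi}}.$$
   Context: Consider the scalar delay differential equation (1) $x'(t)=-\mu f(x(t-1))$, with real parameter $\mu$ and phase space $C([-1,0],\mathbb R)$. Here $f:\mathbb R\to\mathbb R$ is $C^3$ with $f(0)=0$ and $f'(0)=1$, so that $f(\xi)=\xi+B\xi^2+C\xi^3+o(\xi^3)$ with $B=f''(0)/2$ and $C=f'''(0)/6$. For $k\in\mathbb Z$ let $\mu_k=\frac{(4k+1)\pi}{2}$ and $H(k)=\frac{22(4k+1)\pi-8}{15(4k+1)\pi}$. The $k$th Hopf bifurcation (at $\mu_k$) is supercritical if $C<H(k)B^2$ and subcritical if $C>H(k)B^2$; it is called nondegenerate if $C\ne H(k)B^2$. Supercritical means the bifurcating small periodic orbits are stable within the center manifold; subcritical means they are unstable there. Hopf branch notation, for $k\ge0$ with a nondegenerate $k$th bifurcation: put $\delta_k=1$ if it is supercritical and $\delta_k=-1$ if it is subcritical. There are $\eta_k>0$ and a family of nonconstant periodic solutions $p^k_\eta$, $\eta\in(0,\eta_k)$, of (1) with parameter $\mu=\mu_k+\delta_k\eta$. These bifurcate from $0$ at $\mu_k$ (amplitude $\to0$ as $\eta\to0$), and they are locally unique up to time translation. $T^k_\eta$ denotes the minimal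 period of $p^k_\eta$, and $T^k_\eta\to T^k_0:=\frac{4}{4k+1}$ as $\eta\to0$. *)

theory Defs
  imports "HOL-Analysis.Analysis"
begin

definition C3 :: "(real \<Rightarrow> real) \<Rightarrow> bool" where
  "C3 f \<longleftrightarrow> (\<forall>x. f differentiable at x) \<and> (\<forall>x. deriv f differentiable at x)
     \<and> (\<forall>x. deriv (deriv f) differentiable at x)
     \<and> continuous_on UNIV (deriv (deriv (deriv f)))"

definition muk :: "int \<Rightarrow> real" where
  "muk k = (4 * of_int k + 1) * pi / 2"

definition Hk :: "int \<Rightarrow> real" where
  "Hk k = (22 * (4 * of_int k + 1) * pi - 8) / (15 * (4 * of_int k + 1) * pi)"

definition dde_solution :: "(real \<Rightarrow> real) \<Rightarrow> real \<Rightarrow> (real \<Rightarrow> real) \<Rightarrow> bool" where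
  "dde_solution f \<mu> x \<longleftrightarrow> (\<forall>t. (x has_real_derivative (- \<mu> * f (x (t - 1)))) (at t))"

definition minimal_period :: "(real \<Rightarrow> real) \<Rightarrow> real \<Rightarrow> bool" where
  "minimal_period x T \<longleftrightarrow> T > 0 \<and> (\<forall>t. x (t + T) = x t)
     \<and> (\<forall>S. 0 < S \<and> S < T \<longrightarrow> \<not> (\<forall>t. x (t + S) = x t))"

end

theory Submission
  imports Defs
begin

text \<open>
  With $\omega = 2\pi/T$ the claim reads $\mu \le \omega$. Rescale a small orbit to
  $X(s) = x(s/\omega)$, so that $X' = -(\mu/\omega)\, f(X(\cdot - \omega))$ is $2\pi$-periodic, and choose
  the phase so that $X = a\cos + w$ with $w$ free of first harmonics. Modulo $2\pi$ the delay is
  close to $\pi/2$, and $w' + w(\cdot - \pi/2)$ controls $w$; hence $w = O(a^2)$. Comparing first harmonics gives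
  $(\mu/\omega)\,\alpha = a\cos\theta$, where $\alpha$ is the cosine coefficient of $f \circ X$ and
  $\theta = \omega - \mu_k$, so it suffices that $\alpha \ge a$. The zeroth and second harmonics of the equation
  determine $w$ to second order, and
  $\alpha - a = a^3 (\frac34 C - \frac{11}{10} B^2) + o(a^3)$.
  The bracket is positive since $C > H(-1) B^2 \ge \frac{22}{15} B^2$.
\<close>

subsection \<open>Integration over one period\<close>

text \<open>The bracket vanishes at C = (22/15) * B^2, and 22/15 is the limit of H(m) as m grows.
  Since H(m) = 22/15 - 8/(15 * (4*m+1) * pi), subcriticality at an index m \<ge> 0 alone allows C
  below 22/15 * B^2 and thus a negative bracket. Negative indices lie above the limit, so they
  supply the strict inequality: the direction of bifurcation at k and the comparison of \<mu> with
  \<omega> are governed by different thresholds. The obstacle is resonance: cos and sin solve w' +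
  w(. - pi/2) = 0, so this operator controls only functions without first harmonics. The true delay
  differs from pi/2 by \<theta> and the true factor from 1 by lam - 1; both discrepancies are moved
  to the right-hand side and absorbed for small \<epsilon>. All error terms carry explicit numerical
  constants times powers of \<open>K\<close>, \<open>\<epsilon>\<close>, \<open>e\<close> and the
  amplitude. The estimate therefore holds for each small orbit separately, and the limit \<eta> -> 0
  enters only through the choice of one \<open>\<epsilon>\<close>.\<close>

definition period_int :: "(real \<Rightarrow> real) \<Rightarrow> real" where
  "period_int h = integral {0..2*pi} h"

definition cont_periodic :: "(real \<Rightarrow> real) \<Rightarrow> bool" where
  "cont_periodic h \<longleftrightarrow> continuous_on UNIV h \<and> (\<forall>s. h (s + 2*pi) = h s)"

section \<open>Algebra of continuous functions of period 2*pi\<close>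

lemma cont_periodic_cont: "cont_periodic h \<Longrightarrow> continuous_on S h"
  by (auto simp: cont_periodic_def intro: continuous_on_subset)

lemma cont_periodic_of_int:
  assumes "cont_periodic h"
  shows "h (s + of_int n * (2*pi)) = h s"
proof -
  interpret periodic_fun_simple h "2*pi"
    by standard (use assms in \<open>simp add: cont_periodic_def\<close>)
  show ?thesis by (rule plus_of_int)
qed

lemma cont_periodic_shift:
  assumes "cont_periodic h"
  shows "cont_periodic (\<lambda>s. h (s + c))"
proof -
  have "continuous_on UNIV (\<lambda>s. h (s + c))"
    by (rule continuous_on_compose2[OF cont_periodic_cont[OF assms, of UNIV]])
       (auto intro: continuous_intros)
  moreover have "h (s + 2*pi + c) = h (s + c)" for s
    using assms unfolding cont_periodic_def by (metis add.commute add.left_commute)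
  ultimately show ?thesis by (simp add: cont_periodic_def)
qed

lemma cont_periodic_shift_minus:
  "cont_periodic h \<Longrightarrow> cont_periodic (\<lambda>s. h (s - c))"
  using cont_periodic_shift[of h "-c"] by simp

lemma cont_periodic_const: "cont_periodic (\<lambda>s. c)" by (simp add: cont_periodic_def)

lemma cont_periodic_cos:
  "cont_periodic (\<lambda>s. cos s)"
  by (simp add: cont_periodic_def continuous_intros)

lemma cont_periodic_sin:
  "cont_periodic (\<lambda>s. sin s)"
  by (simp add: cont_periodic_def continuous_intros)

lemma cont_periodic_cos2: "cont_periodic (\<lambda>s. cos (2 * s))"
proof -
  have "cos (2 * (s+2*pi)) = cos (2 * s)" for s
    using cos.plus_of_nat[of "2 * s" 2] by (simp add: algebra_simps)
  thus ?thesis by (auto simp: cont_periodic_def intro!: continuous_intros)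
qed

lemma cont_periodic_sin2: "cont_periodic (\<lambda>s. sin (2 * s))"
proof -
  have "sin (2 * (s+2*pi)) = sin (2 * s)" for s
    using sin.plus_of_nat[of "2 * s" 2] by (simp add: algebra_simps)
  thus ?thesis by (auto simp: cont_periodic_def intro!: continuous_intros)
qed

lemma cont_periodic_add:
  "cont_periodic g \<Longrightarrow> cont_periodic h \<Longrightarrow>
    cont_periodic (\<lambda>s. g s + h s)"
  by (simp add: cont_periodic_def continuous_on_add)

lemma cont_periodic_diff:
  "cont_periodic g \<Longrightarrow> cont_periodic h \<Longrightarrow>
    cont_periodic (\<lambda>s. g s - h s)"
  by (simp add: cont_periodic_def continuous_on_diff)

lemma cont_periodic_mult:
  "cont_periodic g \<Longrightarrow> cont_periodic h \<Longrightarrow>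
    cont_periodic (\<lambda>s. g s * h s)"
  by (simp add: cont_periodic_def continuous_on_mult)

lemma cont_periodic_minus: "cont_periodic g \<Longrightarrow> cont_periodic (\<lambda>s. - g s)"
  by (simp add: cont_periodic_def continuous_on_minus)

lemma cont_periodic_divide: "cont_periodic g \<Longrightarrow> cont_periodic (\<lambda>s. g s / c)"
  unfolding divide_inverse by (intro cont_periodic_mult cont_periodic_const)

lemma cont_periodic_power: "cont_periodic g \<Longrightarrow> cont_periodic (\<lambda>s. g s ^ n)"
  by (simp add: cont_periodic_def continuous_on_power)

lemma cont_periodic_comp:
  "continuous_on UNIV f \<Longrightarrow> cont_periodic h \<Longrightarrow>
    cont_periodic (\<lambda>s. f (h s))"
  by (auto simp: cont_periodic_def intro: continuous_on_compose2)

lemmas cont_periodic_intros = cont_periodic_const cont_periodic_cos cont_periodic_sin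
  cont_periodic_cos2 cont_periodic_sin2
  cont_periodic_add cont_periodic_diff cont_periodic_mult
  cont_periodic_minus cont_periodic_divide cont_periodic_power cont_periodic_shift cont_periodic_shift_minus

lemma cont_periodic_integrable: "cont_periodic h \<Longrightarrow> h integrable_on {a..b}"
  by (intro integrable_continuous_real cont_periodic_cont)

section \<open>Linearity, bounds and translation invariance of the period integral\<close>

lemma period_int_add:
  "cont_periodic g \<Longrightarrow> cont_periodic h \<Longrightarrow>
    period_int (\<lambda>s. g s + h s) = period_int g + period_int h"
  unfolding period_int_def by (intro integral_add cont_periodic_integrable)

lemma period_int_diff:
  "cont_periodic g \<Longrightarrow> cont_periodic h \<Longrightarrow>
    period_int (\<lambda>s. g s - h s) = period_int g - period_int h"
  unfolding period_int_def by (intro integral_diff cont_periodic_integrable)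

lemma period_int_cmult: "period_int (\<lambda>s. c * h s) = c * period_int h"
  unfolding period_int_def by simp

lemma period_int_const: "period_int (\<lambda>s. c) = 2 * pi * c"
  unfolding period_int_def by simp

lemma period_int_bound:
  assumes "cont_periodic h" "\<And>s. \<bar>h s\<bar> \<le> m"
  shows "\<bar>period_int h\<bar> \<le> 2 * pi * m"
  using integral_bound[of 0 "2*pi" h m] cont_periodic_cont[OF assms(1)] assms(2)
  by (simp add: period_int_def mult.commute)

text \<open>Trading 2*pi for 7 turns later error constants into plain numerals.\<close>

lemma period_int_bound_7:
  assumes "cont_periodic h" "\<And>s. \<bar>h s\<bar> \<le> m"
  shows "\<bar>period_int h\<bar> \<le> 7 * m"
proof -
  have "0 \<le> m" using assms(2)[of 0] by linarith
  hence "2 * pi * m \<le> 7 * m" using pi_approx by (intro mult_right_mono) auto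
  thus ?thesis using period_int_bound[OF assms] by linarith
qed

lemma abs_mult_le_bound:
  fixes x t b :: real
  assumes "\<bar>x\<bar> \<le> b" "\<bar>t\<bar> \<le> 1" shows "\<bar>x * t\<bar> \<le> b"
  using mult_mono[of "\<bar>x\<bar>" b "\<bar>t\<bar>" 1] assms by (simp add: abs_mult)

lemma period_int_deriv:
  assumes "cont_periodic H" "\<And>s. (H has_real_derivative h s) (at s)"
  shows "period_int h = 0"
proof -
  have "(h has_integral (H (2*pi) - H 0)) {0..2*pi}"
    by (rule fundamental_theorem_of_calculus)
       (auto intro: assms(2) DERIV_subset simp: has_real_derivative_iff_has_vector_derivative[symmetric])
  moreover have "H (2*pi) = H 0" using assms(1) by (metis add_0 cont_periodic_def)
  ultimately show ?thesis by (simp add: period_int_def integral_unique)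
qed

lemma cont_periodic_reduce:
  assumes "cont_periodic h" obtains t n where "t \<in> {0..2*pi}" "s = t + of_int n * (2*pi)"
proof
  define n where "n = \<lfloor>s/(2*pi)\<rfloor>"
  have "of_int n \<le> s/(2*pi)" "s/(2*pi) \<le> of_int n + 1" unfolding n_def by linarith+
  then have "of_int n * (2*pi) \<le> s" "s \<le> (of_int n + 1) * (2*pi)"
    by (simp_all add: pos_le_divide_eq pos_divide_le_eq)
  then show "s - of_int n * (2*pi) \<in> {0..2*pi}" by (auto simp: algebra_simps)
  show "s = s - of_int n * (2*pi) + of_int n * (2*pi)" by simp
qed

text \<open>A shift within one period cuts the window at 2*pi and moves the overhang back by
  periodicity; any other shift reduces to that case. It is what transfers a delay from the solution
  to a test function.\<close>

lemma period_int_shift: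
  assumes "cont_periodic h"
  shows "period_int (\<lambda>s. h (s + c)) = period_int h"
proof -
  have main: "period_int (\<lambda>s. h (s + c)) = period_int h" if "c \<in> {0..2*pi}" for c
  proof -
    have *: "integral {a..b} (\<lambda>x. h (x + d)) = integral {a+d..b+d} h" for a b d
      using integral_shift_real_ivl[of "a+d" d "b+d" h] by simp
    have "period_int (\<lambda>s. h (s + c)) = integral {c..2*pi+c} h" using *[of 0 "2*pi" c] by (simp add: period_int_def)
    also have "\<dots> = integral {c..2*pi} h + integral {2*pi..2*pi+c} h"
      using that by (intro Henstock_Kurzweil_Integration.integral_combine[symmetric] cont_periodic_integrable assms) auto
    also have "integral {2*pi..2*pi+c} h = integral {0..c} (\<lambda>x. h (x + 2*pi))"
      using *[of 0 c "2*pi"] by (simp add: add.commute)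
    also have "\<dots> = integral {0..c} h" using assms by (simp add: cont_periodic_def)
    also have "integral {c..2*pi} h + integral {0..c} h = period_int h"
      unfolding period_int_def using that
      by (subst add.commute, intro Henstock_Kurzweil_Integration.integral_combine cont_periodic_integrable assms) auto
    finally show ?thesis .
  qed
  obtain t n where t: "t \<in> {0..2*pi}" "c = t + of_int n * (2*pi)"
    by (rule cont_periodic_reduce[OF assms])
  have "h (s + c) = h (s + t)" for s
    using cont_periodic_of_int[OF assms, of "s+t" n] t(2) by (simp add: add.assoc)
  with main[OF t(1)] show ?thesis by simp
qed

lemma period_int_shift_minus:
  "cont_periodic h \<Longrightarrow> period_int (\<lambda>s. h (s - c)) = period_int h"
  using period_int_shift[of h "-c"] by simp

text \<open>With zero mean, \<open>r t\<close> is the average of the differences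
  \<open>r t - r x\<close> over one period, and the mean value theorem bounds each of them.\<close>

lemma zero_mean_bound:
  assumes r: "cont_periodic r" and J0: "period_int r = 0" and d: "\<And>s. (r has_real_derivative r' s) (at s)"
    and m: "\<And>s. \<bar>r' s\<bar> \<le> m"
  shows "\<bar>r s\<bar> \<le> 2 * pi * m"
proof -
  obtain t n where t: "t \<in> {0..2*pi}" "s = t + of_int n * (2*pi)"
    by (rule cont_periodic_reduce[OF r])
  have rt: "r s = r t" using cont_periodic_of_int[OF r] t(2) by simp
  have "\<bar>r t - r x\<bar> \<le> 2*pi*m" if x: "x \<in> {0..2*pi}" for x
  proof -
    have "norm (r t - r x) \<le> m * norm (t - x)"
      by (rule field_differentiable_bound[of UNIV r r']) (use d m in auto)
    also have "\<dots> \<le> m * (2*pi)" using t(1) x m[of 0] by (intro mult_left_mono) auto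
    finally show ?thesis by (simp add: mult.commute)
  qed
  hence "\<bar>integral {0..2*pi} (\<lambda>x. r t - r x)\<bar> \<le> 2*pi*m * (2*pi - 0)"
    using integral_bound[of 0 "2*pi" "\<lambda>x. r t - r x" "2*pi*m"] cont_periodic_cont[OF r]
    by (simp add: continuous_intros)
  moreover have "integral {0..2*pi} (\<lambda>x. r t - r x) = 2*pi*r t"
    using period_int_diff[OF cont_periodic_const r, of "r t"] J0 period_int_const[of "r t"] by (simp add: period_int_def)
  ultimately have "2*pi*\<bar>r t\<bar> \<le> 2*pi*(2*pi*m)" by (simp add: abs_mult mult_ac)
  thus ?thesis using rt by simp
qed

lemma cont_periodic_abs_max:
  assumes "cont_periodic w" obtains t where "\<And>s. \<bar>w s\<bar> \<le> \<bar>w t\<bar>"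
proof -
  have "\<exists>t\<in>{0..2*pi}. \<forall>y\<in>{0..2*pi}. \<bar>w y\<bar> \<le> \<bar>w t\<bar>"
    by (rule continuous_attains_sup) (use cont_periodic_cont[OF assms] in \<open>auto intro: continuous_on_rabs\<close>)
  then obtain t where t: "\<And>y. y\<in>{0..2*pi} \<Longrightarrow> \<bar>w y\<bar> \<le> \<bar>w t\<bar>"
    by blast
  show ?thesis
  proof
    fix s
    obtain u n where "u \<in> {0..2*pi}" "s = u + of_int n * (2*pi)"
      by (rule cont_periodic_reduce[OF assms])
    then show "\<bar>w s\<bar> \<le> \<bar>w t\<bar>" using t cont_periodic_of_int[OF assms] by simp
  qed
qed

lemma period_int_trig:
  "period_int (\<lambda>s. cos s) = 0"
  "period_int (\<lambda>s. cos s * cos s) = pi" "period_int (\<lambda>s. cos s * sin s) = 0"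
  "period_int (\<lambda>s. (cos s)^2) = pi" "period_int (\<lambda>s. (cos s)^3) = 0" "period_int (\<lambda>s. (cos s)^4) = 3 * pi / 4"
  "period_int (\<lambda>s. cos s * cos (2 * s)) = 0" "period_int (\<lambda>s. cos s * sin (2 * s)) = 0"
  "period_int (\<lambda>s. (cos s)^2 * cos (2 * s)) = pi / 2" "period_int (\<lambda>s. (cos s)^2 * sin (2 * s)) = 0"
proof -
  \<comment> \<open>Each integral comes from a periodic primitive \<open>H\<close> of the integrand
    minus its mean \<open>c\<close>. The one exception below,
    \<open>(cos s)^2 * cos (2 * s)\<close>, reduces to the second and fourth powers of cos.\<close>
  have eval: "period_int h = 2 * pi * c"
    if "cont_periodic h" "cont_periodic H" "\<And>s. (H has_real_derivative h s - c) (at s)"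
    for h H c
    using period_int_deriv[OF that(2,3)] that(1) by (simp add: period_int_diff period_int_const cont_periodic_const)
  have sc: "(sin s)^2 = 1 - (cos s)^2" for s :: real
    by (rule sin_squared_eq)
  show "period_int (\<lambda>s. cos s) = 0"
    by (subst eval[of "\<lambda>s. cos s" "\<lambda>s. sin s" 0])
       (auto intro!: cont_periodic_intros derivative_eq_intros)
  show c2: "period_int (\<lambda>s. (cos s)^2) = pi"
    by (subst eval[of "\<lambda>s. (cos s)^2" "\<lambda>s. sin s * cos s * (1/2)" "1/2"])
       (auto intro!: cont_periodic_intros derivative_eq_intros simp: sc power2_eq_square[symmetric] field_simps)
  then show "period_int (\<lambda>s. cos s * cos s) = pi" by (simp add: power2_eq_square)
  show "period_int (\<lambda>s. cos s * sin s) = 0"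
    by (subst eval[of "\<lambda>s. cos s * sin s" "\<lambda>s. (sin s)^2 * (1/2)" 0])
       (auto intro!: cont_periodic_intros derivative_eq_intros simp: mult_ac)
  show "period_int (\<lambda>s. (cos s)^3) = 0"
  proof (subst eval[of "\<lambda>s. (cos s)^3" "\<lambda>s. sin s * (cos s)^2 * (1/3) + sin s * (2/3)" 0])
    show "((\<lambda>s. sin s * (cos s)^2 * (1/3) + sin s * (2/3)) has_real_derivative (cos s)^3 - 0) (at s)" for s :: real
      by ((rule derivative_eq_intros refl)+, simp, use sc[of s] in algebra)
  qed (auto intro!: cont_periodic_intros)
  show c4: "period_int (\<lambda>s. (cos s)^4) = 3 * pi / 4"
  proof (subst eval[of "\<lambda>s. (cos s)^4" "\<lambda>s. sin s * (cos s)^3 * (1/4) + sin s * cos s * (3/8)" "3/8"])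
    show "((\<lambda>s. sin s * (cos s)^3 * (1/4) + sin s * cos s * (3/8)) has_real_derivative (cos s)^4 - 3/8) (at s)" for s :: real
      by ((rule derivative_eq_intros refl)+, simp, use sc[of s] in algebra)
  qed (auto intro!: cont_periodic_intros)
  show "period_int (\<lambda>s. cos s * cos (2 * s)) = 0"
  proof (subst eval[of "\<lambda>s. cos s * cos (2 * s)" "\<lambda>s. sin s - (sin s)^3 * (2/3)" 0])
    show "((\<lambda>s. sin s - (sin s)^3 * (2/3)) has_real_derivative cos s * cos (2 * s) - 0) (at s)" for s :: real
      unfolding cos_double by ((rule derivative_eq_intros refl)+, simp, use sc[of s] in algebra)
  qed (auto intro!: cont_periodic_intros)
  show "period_int (\<lambda>s. cos s * sin (2 * s)) = 0"
  proof (subst eval[of "\<lambda>s. cos s * sin (2 * s)" "\<lambda>s. - ((cos s)^3 * (2/3))" 0])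
    show "((\<lambda>s. - ((cos s)^3 * (2/3))) has_real_derivative cos s * sin (2 * s) - 0) (at s)" for s :: real
      unfolding sin_double by ((rule derivative_eq_intros refl)+, simp add: power2_eq_square)
  qed (auto intro!: cont_periodic_intros)
  have "period_int (\<lambda>s. (cos s)^2 * cos (2 * s)) = period_int (\<lambda>s. 2 * (cos s)^4 - (cos s)^2)"
    unfolding cos_double_cos by (rule arg_cong[of _ _ period_int]) (auto simp: algebra_simps power_numeral_reduce)
  then show "period_int (\<lambda>s. (cos s)^2 * cos (2 * s)) = pi / 2"
    by (simp add: period_int_diff cont_periodic_intros period_int_cmult c2 c4)
  show "period_int (\<lambda>s. (cos s)^2 * sin (2 * s)) = 0"
  proof (subst eval[of "\<lambda>s. (cos s)^2 * sin (2 * s)" "\<lambda>s. - ((cos s)^4 * (1/2))" 0])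
    show "((\<lambda>s. - ((cos s)^4 * (1/2))) has_real_derivative (cos s)^2 * sin (2 * s) - 0) (at s)" for s :: real
      unfolding sin_double by ((rule derivative_eq_intros refl)+, simp add: power_numeral_reduce)
  qed (auto intro!: cont_periodic_intros)
qed

subsection \<open>Inverting the resonant delay operator\<close>

text \<open>At a point where the modulus of \<open>w\<close> is largest the derivative vanishes, so
  there \<open>c * w\<close> equals \<open>g\<close>. Either sign of \<open>c\<close> works because
  nothing is integrated forward in time.\<close>

lemma periodic_max_principle:
  assumes w: "cont_periodic w" and d: "\<And>s. (w has_real_derivative g s - c * w s) (at s)"
    and c: "\<bar>c\<bar> = 1" and m: "\<And>s. \<bar>g s\<bar> \<le> m"
  shows "\<bar>w s\<bar> \<le> m"
proof -
  obtain t where t: "\<And>s. \<bar>w s\<bar> \<le> \<bar>w t\<bar>" using cont_periodic_abs_max[OF w] by blast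
  have "g t - c * w t = 0"
  proof (cases "w t \<ge> 0")
    case True
    show ?thesis
      by (rule DERIV_local_max[OF d zero_less_one]) (use t True in \<open>auto intro: order_trans[OF abs_ge_self]\<close>)
  next
    case False
    show ?thesis
      by (rule DERIV_local_min[OF d zero_less_one]) (metis False t abs_of_neg abs_ge_minus_self minus_le_iff neg_le_iff_le not_le order_trans)
  qed
  hence "\<bar>w t\<bar> \<le> m" using m[of t] c by (metis abs_mult diff_eq_eq add_0 mult_1)
  with t[of s] show ?thesis by linarith
qed

text \<open>A translation mixes the two first-order Fourier coefficients by a rotation, so their
  vanishing is translation invariant.\<close>

lemma period_int_cos_shift:
  assumes w: "cont_periodic w" and c: "period_int (\<lambda>s. w s * cos s) = 0" and s: "period_int (\<lambda>s. w s * sin s) = 0"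
  shows "period_int (\<lambda>s. w (s - d) * cos s) = 0" "period_int (\<lambda>s. w (s - d) * sin s) = 0"
proof -
  have "period_int (\<lambda>s. w (s - d) * cos s) = period_int (\<lambda>s. w s * cos (s + d))"
    using period_int_shift_minus[of "\<lambda>s. w s * cos (s + d)" d] by (simp add: cont_periodic_intros w)
  also have "\<dots> = period_int (\<lambda>s. cos d * (w s * cos s) - sin d * (w s * sin s))"
    by (simp add: cos_add algebra_simps)
  also have "\<dots> = 0" by (simp add: period_int_diff period_int_cmult cont_periodic_intros w c s)
  finally show "period_int (\<lambda>s. w (s - d) * cos s) = 0" .
  have "period_int (\<lambda>s. w (s - d) * sin s) = period_int (\<lambda>s. w s * sin (s + d))"
    using period_int_shift_minus[of "\<lambda>s. w s * sin (s + d)" d] by (simp add: cont_periodic_intros w)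
  also have "\<dots> = period_int (\<lambda>s. sin d * (w s * cos s) + cos d * (w s * sin s))"
    by (simp add: sin_add algebra_simps)
  also have "\<dots> = 0" by (simp add: period_int_add period_int_cmult cont_periodic_intros w c s)
  finally show "period_int (\<lambda>s. w (s - d) * sin s) = 0" .
qed

text \<open>
  The shift $S$ by $\pi/2$ satisfies $S^4 = 1$ on $2\pi$-periodic functions. On its eigenspaces for $\pm 1$ the
  equation becomes a scalar equation with a maximum principle; on $S^2 = -1$ it becomes a
  forced rotation at the resonant frequency, which is where vanishing first harmonics are needed.
\<close>
lemma delay_resolvent_bound:
  assumes w: "cont_periodic w" and d: "\<And>s. (w has_real_derivative g s - w (s - pi/2)) (at s)"
    and g: "\<And>s. \<bar>g s\<bar> \<le> G"
    and c0: "period_int (\<lambda>s. w s * cos s) = 0" and s0: "period_int (\<lambda>s. w s * sin s) = 0"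
  shows "\<bar>w s\<bar> \<le> 28 * G"
proof -
  define w1 w2 w3 where "w1 = (\<lambda>s. w (s - pi/2))" and "w2 = (\<lambda>s. w (s - pi))"
    and "w3 = (\<lambda>s. w (s - 3*pi/2))"
  define g1 g2 g3 where "g1 = (\<lambda>s. g (s - pi/2))" and "g2 = (\<lambda>s. g (s - pi))"
    and "g3 = (\<lambda>s. g (s - 3*pi/2))"
  have shifts: "cont_periodic w1" "cont_periodic w2" "cont_periodic w3"
    by (simp_all add: w1_def w2_def w3_def cont_periodic_intros w)
  have dsh: "((\<lambda>s. w (s - c)) has_real_derivative g (s - c) - w (s - c - pi/2)) (at s)" for c s
    using d[of "s - c"] DERIV_shift[of w _ s "-c"] by simp
  have w4: "w (s - 2*pi) = w s" for s
    using w unfolding cont_periodic_def by (metis diff_add_cancel)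
  have dw: "(w has_real_derivative g s - w1 s) (at s)" for s using d[of s] by (simp add: w1_def)
  have dw1: "(w1 has_real_derivative g1 s - w2 s) (at s)" for s
    using dsh[of "pi/2" s] by (simp add: w1_def w2_def g1_def diff_diff_eq)
  have dw2: "(w2 has_real_derivative g2 s - w3 s) (at s)" for s
    using dsh[of "pi" s] by (simp add: w2_def w3_def g2_def diff_diff_eq)
  \<comment> \<open>Periodicity turns the shift by 2*pi into the identity, which closes the four
    equations into a cycle.\<close>
  have dw3: "(w3 has_real_derivative g3 s - w s) (at s)" for s
    using dsh[of "3*pi/2" s] w4[of s] by (simp add: w3_def g3_def diff_diff_eq)
  have gb: "\<bar>g s\<bar> \<le> G" "\<bar>g1 s\<bar> \<le> G" "\<bar>g2 s\<bar> \<le> G" "\<bar>g3 s\<bar> \<le> G" for s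
    using g by (auto simp: g1_def g2_def g3_def)

  \<comment> \<open>The projection onto the eigenvalue 1 of the quarter-period shift; on it the
    delay term is just \<open>p\<close>.\<close>
  define p where "p = (\<lambda>s. (w s + w1 s + w2 s + w3 s) / 4)"
  have "\<bar>p s\<bar> \<le> G"
  proof (rule periodic_max_principle[where w = p and c = 1])
    show "cont_periodic p" unfolding p_def divide_inverse by (intro cont_periodic_intros shifts w)
    show "(p has_real_derivative (g s + g1 s + g2 s + g3 s) / 4 - 1 * p s) (at s)" for s
      unfolding p_def by (rule derivative_eq_intros dw dw1 dw2 dw3 refl)+ (simp_all add: field_simps)
    show "\<bar>(g s + g1 s + g2 s + g3 s) / 4\<bar> \<le> G" for s using gb[of s] by (simp add: abs_le_iff)
  qed simp

  \<comment> \<open>The projection onto the eigenvalue -1, where the delay term becomes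
    \<open>- m\<close>.\<close>
  define m where "m = (\<lambda>s. (w s - w1 s + w2 s - w3 s) / 4)"
  have "\<bar>m s\<bar> \<le> G"
  proof (rule periodic_max_principle[where w = m and c = "-1"])
    show "cont_periodic m" unfolding m_def divide_inverse by (intro cont_periodic_intros shifts w)
    show "(m has_real_derivative (g s - g1 s + g2 s - g3 s) / 4 - (-1) * m s) (at s)" for s
      unfolding m_def by (rule derivative_eq_intros dw dw1 dw2 dw3 refl)+ (simp_all add: field_simps)
    show "\<bar>(g s - g1 s + g2 s - g3 s) / 4\<bar> \<le> G" for s using gb[of s] by (simp add: abs_le_iff)
  qed simp

  \<comment> \<open>\<open>v\<close> is the part of \<open>w\<close> that changes sign under a
    half-period shift, and \<open>z\<close> is its quarter-period shift. The pair satisfies v' = h -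
    z, z' = k + v, a forced rotation of frequency one.\<close>
  define v z where "v = (\<lambda>s. (w s - w2 s) / 2)" and "z = (\<lambda>s. (w1 s - w3 s) / 2)"
  define h k where "h = (\<lambda>s. (g s - g2 s) / 2)" and "k = (\<lambda>s. (g1 s - g3 s) / 2)"
  have pv: "cont_periodic v" "cont_periodic z" unfolding v_def z_def divide_inverse by (intro cont_periodic_intros shifts w)+
  have dv: "(v has_real_derivative h s - z s) (at s)" for s
    unfolding v_def h_def z_def
    by (rule derivative_eq_intros dw dw1 dw2 dw3 refl)+ (simp_all add: field_simps)
  have dz: "(z has_real_derivative k s + v s) (at s)" for s
    unfolding v_def k_def z_def
    by (rule derivative_eq_intros dw dw1 dw2 dw3 refl)+ (simp_all add: field_simps)
  have hk: "\<bar>h s\<bar> \<le> G" "\<bar>k s\<bar> \<le> G" for s using gb[of s] by (auto simp: h_def k_def)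
  have Gtrig: "\<bar>x * cos s + y * sin s\<bar> \<le> 2 * G" if "\<bar>x\<bar> \<le> G" "\<bar>y\<bar> \<le> G" for x y s
  proof -
    have "\<bar>x * cos s\<bar> \<le> G * 1" "\<bar>y * sin s\<bar> \<le> G * 1"
      unfolding abs_mult using that by (intro mult_mono; simp)+
    then show ?thesis by linarith
  qed
  note Jw = period_int_cos_shift[OF w c0 s0]
  have Jv: "period_int (\<lambda>s. v s * cos s) = 0" "period_int (\<lambda>s. v s * sin s) = 0"
       "period_int (\<lambda>s. z s * cos s) = 0" "period_int (\<lambda>s. z s * sin s) = 0"
  proof -
    have half: "(a - b) / 2 * c = (1/2) * (a * c - b * c)" for a b c :: real
      by (simp add: field_simps)
    show "period_int (\<lambda>s. v s * cos s) = 0" "period_int (\<lambda>s. v s * sin s) = 0"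
       "period_int (\<lambda>s. z s * cos s) = 0" "period_int (\<lambda>s. z s * sin s) = 0"
      unfolding v_def z_def half period_int_cmult w1_def w2_def w3_def
      by (simp_all add: period_int_diff cont_periodic_intros w Jw c0 s0)
  qed

  \<comment> \<open>\<open>r1\<close> and \<open>r2\<close> are \<open>v\<close> and
    \<open>z\<close> in the frame rotating with the free motion: only the forcing is left in their
    derivatives. Their means are combinations of first harmonics, hence zero, so
    \<open>zero_mean_bound\<close> applies.\<close>
  define r1 where "r1 = (\<lambda>s. v s * cos s + z s * sin s)"
  have r1: "\<bar>r1 s\<bar> \<le> 2 * pi * (2 * G)"
  proof (rule zero_mean_bound[where r = r1])
    show "cont_periodic r1" unfolding r1_def by (intro cont_periodic_intros pv)
    show "period_int r1 = 0" unfolding r1_def by (simp add: period_int_add cont_periodic_intros pv Jv)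
    show "(r1 has_real_derivative h s * cos s + k s * sin s) (at s)" for s
      unfolding r1_def by (rule derivative_eq_intros dv dz refl)+ (simp add: algebra_simps)
    show "\<bar>h s * cos s + k s * sin s\<bar> \<le> 2 * G" for s by (rule Gtrig[OF hk])
  qed

  define r2 where "r2 = (\<lambda>s. z s * cos s - v s * sin s)"
  have r2: "\<bar>r2 s\<bar> \<le> 2 * pi * (2 * G)"
  proof (rule zero_mean_bound[where r = r2])
    show "cont_periodic r2" unfolding r2_def by (intro cont_periodic_intros pv)
    show "period_int r2 = 0" unfolding r2_def by (simp add: period_int_diff cont_periodic_intros pv Jv)
    show "(r2 has_real_derivative k s * cos s + (- h s) * sin s) (at s)" for s
      unfolding r2_def by (rule derivative_eq_intros dv dz refl)+ (simp add: algebra_simps)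
    show "\<bar>k s * cos s + (- h s) * sin s\<bar> \<le> 2 * G" for s by (rule Gtrig) (use hk in auto)
  qed

  have "r1 s * cos s - r2 s * sin s = v s * ((sin s)\<^sup>2 + (cos s)\<^sup>2)"
    unfolding r1_def r2_def by algebra
  hence v: "v s = r1 s * cos s - r2 s * sin s" by simp
  have G0: "G \<ge> 0" using g[of 0] by linarith
  have "\<bar>r1 s * cos s\<bar> \<le> 2 * pi * (2 * G) * 1" "\<bar>r2 s * sin s\<bar> \<le> 2 * pi * (2 * G) * 1"
    unfolding abs_mult using r1 r2 G0 by (intro mult_mono; simp)+
  hence "\<bar>v s\<bar> \<le> 8 * (pi * G)" using v by linarith
  \<comment> \<open>The three parts add up to 2*G + 8*3.2*G = 27.6*G, which is rounded up to
    28*G.\<close>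
  moreover have "pi * G \<le> 3.2 * G" using pi_approx G0 by (intro mult_right_mono) auto
  moreover have "w s = p s + m s + v s" unfolding p_def m_def v_def by (simp add: field_simps)
  ultimately show ?thesis using \<open>\<bar>p s\<bar> \<le> G\<close> \<open>\<bar>m s\<bar> \<le> G\<close> G0 by linarith
qed

subsection \<open>Harmonic analysis of a rescaled small orbit\<close>

text \<open>
  In the application \<open>lam\<close> is $\mu/\omega$ and $\theta = \omega - \mu_k$, so that $\pi/2 + \theta$ agrees with
  the rescaled delay $\omega$ modulo $2\pi$.
\<close>
locale scaled_orbit =
  fixes f X :: "real \<Rightarrow> real" and lam \<theta> \<epsilon> B C e K :: real
  assumes cont_f: "continuous_on UNIV f"
    and X: "cont_periodic X"
    and dX: "\<And>s. (X has_real_derivative - lam * f (X (s - (pi/2 + \<theta>)))) (at s)"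
    and X_sin: "period_int (\<lambda>s. X s * sin s) = 0"
    and X_cos: "period_int (\<lambda>s. X s * cos s) \<ge> 0"
    and X_nz: "\<exists>s. X s \<noteq> 0"
    and lam_near: "\<bar>lam - 1\<bar> \<le> \<epsilon>" and theta_near: "\<bar>\<theta>\<bar> \<le> \<epsilon>" and X_small: "\<And>s. \<bar>X s\<bar> \<le> \<epsilon>"
    and taylor: "\<And>x. \<bar>x\<bar> \<le> \<epsilon> \<Longrightarrow> \<bar>f x - x - B * x^2 - C * x^3\<bar> \<le> e * \<bar>x\<bar>^3"
    and e_pos: "e > 0"
    and K_def: "K = \<bar>B\<bar> + \<bar>C\<bar> + e + 1"
    and eps_small: "1232 * K * \<epsilon> \<le> 1"
begin

definition "a = period_int (\<lambda>s. X s * cos s) / pi"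
definition "w s = X s - a * cos s"
definition "F s = f (X s)"
definition "N s = F s - X s"
definition "\<alpha> = period_int (\<lambda>s. F s * cos s) / pi"
definition "\<beta> = period_int (\<lambda>s. F s * sin s) / pi"

section \<open>Smallness of the parameters and balance of the harmonics of order 0, 1 and 2\<close>

lemma K_ge_1: "K \<ge> 1" using e_pos by (simp add: K_def)

lemma eps_bounds: "0 \<le> \<epsilon>" "\<epsilon> \<le> 1/1232"
proof -
  show "0 \<le> \<epsilon>" using theta_near by linarith
  hence "1 * \<epsilon> \<le> K * \<epsilon>" using K_ge_1 by (intro mult_right_mono) auto
  thus "\<epsilon> \<le> 1/1232" using eps_small by simp
qed

lemma lam_bounds: "1/2 \<le> lam" "lam \<le> 2"
  using lam_near eps_bounds by linarith+

lemma cont_periodic_F: "cont_periodic F" unfolding F_def using cont_periodic_comp[OF cont_f X] .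

lemma cont_periodic_w: "cont_periodic w" unfolding w_def by (intro cont_periodic_intros X)

lemma cont_periodic_N:
  "cont_periodic N" unfolding N_def by (intro cont_periodic_intros X cont_periodic_F)

lemmas orbit_periodic = cont_periodic_intros X cont_periodic_F cont_periodic_w cont_periodic_N

text \<open>The weak form of the equation: the derivative of \<open>X s * \<phi> s\<close> has zero
  period integral, and translation invariance moves the delay onto the test function.\<close>

lemma harmonic_balance:
  assumes "cont_periodic \<phi>" "cont_periodic \<phi>'" "\<And>s. (\<phi> has_real_derivative \<phi>' s) (at s)"
  shows "period_int (\<lambda>s. X s * \<phi>' s) = lam * period_int (\<lambda>s. F s * \<phi> (s + (pi/2 + \<theta>)))"
proof -
  let ?d = "pi/2 + \<theta>"
  have "period_int (\<lambda>s. X s * \<phi>' s - lam * (F (s - ?d) * \<phi> s)) = 0"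
  proof (rule period_int_deriv)
    show "cont_periodic (\<lambda>s. X s * \<phi> s)" by (intro orbit_periodic assms)
    show "((\<lambda>s. X s * \<phi> s) has_real_derivative X s * \<phi>' s - lam * (F (s - ?d) * \<phi> s)) (at s)" for s
      unfolding F_def by (rule derivative_eq_intros dX assms(3) refl)+ (simp add: algebra_simps)
  qed
  hence "period_int (\<lambda>s. X s * \<phi>' s) = lam * period_int (\<lambda>s. F (s - ?d) * \<phi> s)"
    by (simp add: period_int_diff period_int_cmult orbit_periodic assms)
  also have "period_int (\<lambda>s. F (s - ?d) * \<phi> s) = period_int (\<lambda>s. F s * \<phi> (s + ?d))"
    using period_int_shift_minus[of "\<lambda>s. F s * \<phi> (s + ?d)" ?d] by (simp add: orbit_periodic assms)
  finally show ?thesis .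
qed

lemma harmonic_0: "period_int F = 0"
  using harmonic_balance[of "\<lambda>_. 1" "\<lambda>_. 0"] lam_bounds by (simp add: cont_periodic_const period_int_const)

lemma sin_shift: "sin (s + (pi/2 + \<theta>)) = cos \<theta> * cos s - sin \<theta> * sin s"
  "cos (s + (pi/2 + \<theta>)) = - (sin \<theta> * cos s + cos \<theta> * sin s)"
  by (simp_all add: sin_add cos_add algebra_simps)

text \<open>Testing with sin and cos gives a linear system for \<alpha> and \<beta> whose matrix is
  \<open>lam\<close> times the rotation by \<theta>. The phase condition \<open>X_sin\<close> makes
  one right-hand side zero; inverting the rotation gives both formulas.\<close>

lemma harmonic_1: "lam * \<alpha> = a * cos \<theta>" "lam * \<beta> = - a * sin \<theta>"
proof -
  have "period_int (\<lambda>s. X s * cos s) = lam * period_int (\<lambda>s. F s * sin (s + (pi/2 + \<theta>)))"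
    by (rule harmonic_balance) (auto intro: orbit_periodic intro!: derivative_eq_intros)
  also have "period_int (\<lambda>s. F s * sin (s + (pi/2 + \<theta>))) =
      period_int (\<lambda>s. cos \<theta> * (F s * cos s) - sin \<theta> * (F s * sin s))"
    unfolding sin_shift by (simp add: algebra_simps)
  also have "\<dots> = cos \<theta> * (pi * \<alpha>) - sin \<theta> * (pi * \<beta>)"
    by (simp add: period_int_diff period_int_cmult orbit_periodic \<alpha>_def \<beta>_def)
  finally have "pi * a = pi * (lam * (cos \<theta> * \<alpha> - sin \<theta> * \<beta>))"
    by (simp add: a_def algebra_simps)
  hence 1: "a = lam * (cos \<theta> * \<alpha> - sin \<theta> * \<beta>)" by simp
  have "period_int (\<lambda>s. X s * - sin s) = lam * period_int (\<lambda>s. F s * cos (s + (pi/2 + \<theta>)))"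
    by (rule harmonic_balance) (auto intro: orbit_periodic intro!: derivative_eq_intros)
  also have "period_int (\<lambda>s. F s * cos (s + (pi/2 + \<theta>))) =
      period_int (\<lambda>s. (- sin \<theta>) * (F s * cos s) - cos \<theta> * (F s * sin s))"
    unfolding sin_shift by (simp add: algebra_simps)
  also have "\<dots> = (- sin \<theta>) * period_int (\<lambda>s. F s * cos s) - cos \<theta> * period_int (\<lambda>s. F s * sin s)"
    by (subst period_int_diff) (simp_all only: period_int_cmult orbit_periodic)
  also have "\<dots> = - (pi * (sin \<theta> * \<alpha> + cos \<theta> * \<beta>))"
    by (simp add: \<alpha>_def \<beta>_def algebra_simps)
  also have "period_int (\<lambda>s. X s * - sin s) = 0" using period_int_cmult[of "-1" "\<lambda>s. X s * sin s"] X_sin by simp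
  finally have 2: "sin \<theta> * \<alpha> + cos \<theta> * \<beta> = 0" using lam_bounds by simp
  have 3: "sin \<theta> * sin \<theta> + cos \<theta> * cos \<theta> = 1"
    by (simp flip: power2_eq_square)
  show "lam * \<alpha> = a * cos \<theta>" "lam * \<beta> = - a * sin \<theta>" using 1 2 3 by algebra+
qed

text \<open>The second harmonic sees twice the delay, pi + 2*\<theta>, whence the signs. For lam = 1
  and \<theta> = 0 the relations read 2*P = -Fs and 2*Q = Fc.\<close>

lemma harmonic_2:
  defines "P \<equiv> period_int (\<lambda>s. X s * cos (2 * s))" and "Q \<equiv> period_int (\<lambda>s. X s * sin (2 * s))"
    and "Fc \<equiv> period_int (\<lambda>s. F s * cos (2 * s))" and "Fs \<equiv> period_int (\<lambda>s. F s * sin (2 * s))"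
  shows "2 * P = - lam * (Fs * cos (2 * \<theta>) + Fc * sin (2 * \<theta>))"
    "2 * Q = lam * (Fc * cos (2 * \<theta>) - Fs * sin (2 * \<theta>))"
proof -
  have sh: "2 * (s + (pi/2 + \<theta>)) = (2 * s + 2 * \<theta>) + pi" for s by simp
  have s2: "sin (2 * (s + (pi/2 + \<theta>))) = - (sin (2 * s) * cos (2 * \<theta>) + cos (2 * s) * sin (2 * \<theta>))" for s
    unfolding sh sin_periodic_pi by (simp add: sin_add)
  have c2: "cos (2 * (s + (pi/2 + \<theta>))) = - (cos (2 * s) * cos (2 * \<theta>) - sin (2 * s) * sin (2 * \<theta>))" for s
    unfolding sh cos_periodic_pi by (simp add: cos_add)
  have "period_int (\<lambda>s. X s * (2 * cos (2 * s))) = lam * period_int (\<lambda>s. F s * sin (2 * (s + (pi/2 + \<theta>))))"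
    by (rule harmonic_balance[of "\<lambda>s. sin (2 * s)"]) (auto intro!: orbit_periodic derivative_eq_intros)
  also have "period_int (\<lambda>s. F s * sin (2 * (s + (pi/2 + \<theta>)))) =
     period_int (\<lambda>s. (- cos (2 * \<theta>)) * (F s * sin (2 * s)) - sin (2 * \<theta>) * (F s * cos (2 * s)))"
    unfolding s2 by (rule arg_cong[of _ _ period_int]) (simp add: fun_eq_iff algebra_simps)
  also have "\<dots> = (- cos (2 * \<theta>)) * Fs - sin (2 * \<theta>) * Fc"
    by (subst period_int_diff) (simp_all only: period_int_cmult Fs_def Fc_def orbit_periodic)
  also have "period_int (\<lambda>s. X s * (2 * cos (2 * s))) = 2 * P"
    using period_int_cmult[of 2 "\<lambda>s. X s * cos (2 * s)"] by (simp add: P_def mult_ac)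
  finally show "2 * P = - lam * (Fs * cos (2 * \<theta>) + Fc * sin (2 * \<theta>))"
    by (simp add: algebra_simps)
  have "period_int (\<lambda>s. X s * (- 2 * sin (2 * s))) = lam * period_int (\<lambda>s. F s * cos (2 * (s + (pi/2 + \<theta>))))"
    by (rule harmonic_balance[of "\<lambda>s. cos (2 * s)"]) (auto intro!: orbit_periodic derivative_eq_intros)
  also have "period_int (\<lambda>s. F s * cos (2 * (s + (pi/2 + \<theta>)))) =
     period_int (\<lambda>s. sin (2 * \<theta>) * (F s * sin (2 * s)) - cos (2 * \<theta>) * (F s * cos (2 * s)))"
    unfolding c2 by (rule arg_cong[of _ _ period_int]) (simp add: fun_eq_iff algebra_simps)
  also have "\<dots> = sin (2 * \<theta>) * Fs - cos (2 * \<theta>) * Fc"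
    by (subst period_int_diff) (simp_all only: period_int_cmult Fs_def Fc_def orbit_periodic)
  also have "period_int (\<lambda>s. X s * (- 2 * sin (2 * s))) = - 2 * Q"
    using period_int_cmult[of "-2" "\<lambda>s. X s * sin (2 * s)"] by (simp add: Q_def mult_ac)
  finally show "2 * Q = lam * (Fc * cos (2 * \<theta>) - Fs * sin (2 * \<theta>))"
    by (simp add: algebra_simps)
qed

section \<open>The remainder \<open>w\<close> is quadratic in the amplitude\<close>

lemma period_int_w_trig:
  "period_int (\<lambda>s. w s * cos s) = 0" "period_int (\<lambda>s. w s * sin s) = 0"
proof -
  have "period_int (\<lambda>s. w s * cos s) = period_int (\<lambda>s. X s * cos s - a * (cos s * cos s))"
    by (rule arg_cong[of _ _ period_int]) (simp add: fun_eq_iff w_def algebra_simps)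
  also have "\<dots> = period_int (\<lambda>s. X s * cos s) - a * pi"
    by (subst period_int_diff) (simp_all only: period_int_cmult period_int_trig orbit_periodic)
  also have "\<dots> = 0" by (simp add: a_def)
  finally show "period_int (\<lambda>s. w s * cos s) = 0" .
  have "period_int (\<lambda>s. w s * sin s) = period_int (\<lambda>s. X s * sin s - a * (cos s * sin s))"
    by (rule arg_cong[of _ _ period_int]) (simp add: fun_eq_iff w_def algebra_simps)
  also have "\<dots> = 0"
    by (simp add: period_int_diff period_int_cmult orbit_periodic period_int_trig X_sin)
  finally show "period_int (\<lambda>s. w s * sin s) = 0" .
qed

lemma harmonic_1_N:
  "pi * (\<alpha> - a) = period_int (\<lambda>s. N s * cos s)" "pi * \<beta> = period_int (\<lambda>s. N s * sin s)"
proof -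
  have "period_int (\<lambda>s. N s * cos s) = period_int (\<lambda>s. F s * cos s) - period_int (\<lambda>s. X s * cos s)"
    unfolding N_def left_diff_distrib by (intro period_int_diff orbit_periodic)
  thus "pi * (\<alpha> - a) = period_int (\<lambda>s. N s * cos s)"
    by (simp add: \<alpha>_def a_def algebra_simps)
  have "period_int (\<lambda>s. N s * sin s) = period_int (\<lambda>s. F s * sin s) - period_int (\<lambda>s. X s * sin s)"
    unfolding N_def left_diff_distrib by (intro period_int_diff orbit_periodic)
  thus "pi * \<beta> = period_int (\<lambda>s. N s * sin s)" by (simp add: \<beta>_def X_sin)
qed

text \<open>The remainder solves a linear delay equation forced by \<open>N\<close> without its
  first harmonic. Replacing its factor and delay by 1 and pi/2 costs a small multiple of sup |w|,
  which the resolvent bound allows to be absorbed on the left.\<close>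

lemma w_bound:
  assumes n: "\<And>s. \<bar>N s\<bar> \<le> n"
  shows "\<bar>w s\<bar> \<le> 616 * n"
proof -
  let ?d = "pi/2 + \<theta>"
  \<comment> \<open>Minus \<open>N\<close> with its first harmonic removed: by
    \<open>harmonic_1_N\<close>, \<alpha> - a and \<beta> are the first-order coefficients of
    \<open>N\<close>. The bound 5*n below is n + 2*n + 2*n.\<close>
  define H where "H s = - N s + (\<alpha> - a) * cos s + \<beta> * sin s" for s
  have n0: "n \<ge> 0" using n[of 0] by linarith
  have "\<bar>period_int (\<lambda>s. N s * cos s)\<bar> \<le> 2 * pi * n" "\<bar>period_int (\<lambda>s. N s * sin s)\<bar> \<le> 2 * pi * n"
    by (intro period_int_bound abs_mult_le_bound n orbit_periodic; simp)+
  hence "pi * \<bar>\<alpha> - a\<bar> \<le> pi * (2 * n)" "pi * \<bar>\<beta>\<bar> \<le> pi * (2 * n)"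
    by (simp_all flip: harmonic_1_N add: abs_mult)
  hence ab: "\<bar>\<alpha> - a\<bar> \<le> 2 * n" "\<bar>\<beta>\<bar> \<le> 2 * n" by simp_all
  have H: "\<bar>H s\<bar> \<le> 5 * n" for s
    using n[of s] abs_mult_le_bound[OF ab(1), of "cos s"] abs_mult_le_bound[OF ab(2), of "sin s"]
    unfolding H_def by simp
  have lamH: "\<bar>lam * H s\<bar> \<le> 10 * n" for s
    using mult_mono[of lam 2 "\<bar>H s\<bar>" "5 * n"] H[of s] lam_bounds n0 by (simp add: abs_mult)
  have dw: "(w has_real_derivative - lam * w (s - ?d) + lam * H (s - ?d)) (at s)" for s
  proof -
    have "sin s = sin ((s - ?d) + ?d)" by simp
    also have "\<dots> = cos \<theta> * cos (s - ?d) - sin \<theta> * sin (s - ?d)"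
      by (rule sin_shift)
    finally have "a * sin s = a * (cos \<theta> * cos (s - ?d) - sin \<theta> * sin (s - ?d))"
      by (rule arg_cong)
    also have "\<dots> = (a * cos \<theta>) * cos (s - ?d) + (- a * sin \<theta>) * sin (s - ?d)"
      by (simp add: right_diff_distrib)
    also have "\<dots> = lam * (\<alpha> * cos (s - ?d) + \<beta> * sin (s - ?d))"
      unfolding harmonic_1[symmetric] by (simp add: algebra_simps)
    finally have as: "a * sin s = lam * (\<alpha> * cos (s - ?d) + \<beta> * sin (s - ?d))" .
    have "(w has_real_derivative - lam * F (s - ?d) + a * sin s) (at s)"
      unfolding w_def[abs_def] F_def by (rule derivative_eq_intros dX refl)+ simp
    moreover have "- lam * F (s - ?d) + a * sin s = - lam * w (s - ?d) + lam * H (s - ?d)"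
      unfolding as H_def N_def w_def by (simp add: algebra_simps)
    ultimately show ?thesis by simp
  qed
  obtain t where t: "\<And>s. \<bar>w s\<bar> \<le> \<bar>w t\<bar>" using cont_periodic_abs_max[OF cont_periodic_w] by blast
  define W where "W = \<bar>w t\<bar>"
  have W: "\<bar>w s\<bar> \<le> W" for s using t W_def by simp
  have W0: "W \<ge> 0" by (simp add: W_def)
  \<comment> \<open>The equation itself bounds w', hence the effect of changing the delay by
    \<theta>.\<close>
  have lip: "\<bar>w s - w r\<bar> \<le> (2 * W + 10 * n) * \<bar>s - r\<bar>" for s r
  proof -
    have "norm (w s - w r) \<le> (2 * W + 10 * n) * norm (s - r)"
    proof (rule field_differentiable_bound[of UNIV w "\<lambda>s. - lam * w (s - ?d) + lam * H (s - ?d)"])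
      show "norm (- lam * w (s - ?d) + lam * H (s - ?d)) \<le> 2 * W + 10 * n" for s
      proof -
        have "\<bar>lam * w (s - ?d)\<bar> \<le> 2 * W"
          unfolding abs_mult using lam_bounds W W0 by (intro mult_mono) auto
        thus ?thesis using lamH[of "s - ?d"] by (simp add: abs_le_iff)
      qed
    qed (use dw in auto)
    thus ?thesis by simp
  qed
  define g where "g s = w (s - pi/2) - lam * w (s - ?d) + lam * H (s - ?d)" for s
  have e0: "0 \<le> \<epsilon>" by (rule eps_bounds)
  have g: "\<bar>g s\<bar> \<le> 5 * (\<epsilon> * W) + 11 * n" for s
  proof -
    have eq: "g s = (1 - lam) * w (s - pi/2) + lam * (w (s - pi/2) - w (s - ?d)) + lam * H (s - ?d)"
      by (simp add: g_def algebra_simps)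
    have 1: "\<bar>(1 - lam) * w (s - pi/2)\<bar> \<le> \<epsilon> * W"
      unfolding abs_mult using lam_near W e0 by (intro mult_mono) auto
    have "\<bar>w (s - pi/2) - w (s - ?d)\<bar> \<le> (2 * W + 10 * n) * \<bar>\<theta>\<bar>"
      using lip[of "s - pi/2" "s - ?d"] by simp
    also have "\<dots> \<le> (2 * W + 10 * n) * \<epsilon>"
      using theta_near W0 n0 by (intro mult_left_mono) auto
    finally have 2: "\<bar>lam * (w (s - pi/2) - w (s - ?d))\<bar> \<le> 2 * ((2 * W + 10 * n) * \<epsilon>)"
      unfolding abs_mult using lam_bounds W0 n0 e0 by (intro mult_mono) auto
    have "n * \<epsilon> \<le> n * (1/20)" using n0 eps_bounds by (intro mult_left_mono) auto
    with 1 2 lamH[of "s - ?d"] show ?thesis unfolding eq by (simp add: algebra_simps abs_le_iff)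
  qed
  have "\<bar>w t\<bar> \<le> 28 * (5 * (\<epsilon> * W) + 11 * n)"
  proof (rule delay_resolvent_bound[OF cont_periodic_w _ g period_int_w_trig])
    show "(w has_real_derivative g s - w (s - pi/2)) (at s)" for s
      using dw[of s] by (simp add: g_def)
  qed
  \<comment> \<open>The term 140*\<epsilon>*W is at most W/2, so moving it to the left doubles 308
    to 616.\<close>
  hence "W \<le> 140 * (\<epsilon> * W) + 308 * n" unfolding W_def[symmetric] by (simp add: algebra_simps)
  moreover have "140 * (\<epsilon> * W) \<le> W / 2"
    using mult_right_mono[of "140 * \<epsilon>" "1/2" W] eps_bounds W0 by simp
  ultimately have "W \<le> 616 * n" by simp
  with W[of s] show ?thesis by linarith
qed

lemma f_quadratic:
  assumes "\<bar>x\<bar> \<le> \<epsilon>"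
  shows "\<bar>f x - x\<bar> \<le> K * x^2" "\<bar>f x - x - B * x^2\<bar> \<le> K * \<bar>x\<bar>^3"
proof -
  have 1: "\<bar>x\<bar>^3 \<le> x^2"
    using mult_right_mono[of "\<bar>x\<bar>" 1 "x^2"] assms eps_bounds by (simp add: power3_eq_cube power2_eq_square)
  have t: "\<bar>f x - x - B * x^2 - C * x^3\<bar> \<le> e * \<bar>x\<bar>^3"
    by (rule taylor[OF assms])
  have C: "\<bar>C * x^3\<bar> = \<bar>C\<bar> * \<bar>x\<bar>^3" and B: "\<bar>B * x^2\<bar> = \<bar>B\<bar> * x^2"
    by (simp_all add: abs_mult power_abs)
  have e: "e * \<bar>x\<bar>^3 \<le> e * x^2" "\<bar>C\<bar> * \<bar>x\<bar>^3 \<le> \<bar>C\<bar> * x^2" using 1 e_pos by (intro mult_left_mono; simp)+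
  have "\<bar>f x - x - B * x^2\<bar> \<le> (\<bar>C\<bar> + e) * \<bar>x\<bar>^3" using t C by (simp add: algebra_simps)
  also have "\<dots> \<le> K * \<bar>x\<bar>^3" by (intro mult_right_mono) (simp_all add: K_def)
  finally show "\<bar>f x - x - B * x^2\<bar> \<le> K * \<bar>x\<bar>^3" .
  have "\<bar>f x - x\<bar> \<le> (\<bar>B\<bar> + \<bar>C\<bar> + e) * x^2" using t C B e by (simp add: algebra_simps) linarith
  also have "\<dots> \<le> K * x^2" by (intro mult_right_mono) (simp_all add: K_def)
  finally show "\<bar>f x - x\<bar> \<le> K * x^2" .
qed

text \<open>Nonlinear terms are at first controlled only by the maximum \<open>M\<close> of |X|,
  since \<open>a\<close> might vanish. But \<open>w\<close> is at most M/2, so M \<le> a + M/2; a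
  nonzero orbit thus has a > 0, and \<open>M\<close> may be replaced by 2*a everywhere. The constant
  2464 is 4 * 616.\<close>

lemma amplitude: "a > 0" "\<bar>X s\<bar> \<le> 2 * a" "\<bar>w s\<bar> \<le> 2464 * K * a^2"
proof -
  obtain t where t: "\<And>s. \<bar>X s\<bar> \<le> \<bar>X t\<bar>" using cont_periodic_abs_max[OF X] by blast
  define M where "M = \<bar>X t\<bar>"
  have M: "\<bar>X s\<bar> \<le> M" for s using t M_def by simp
  have Mpos: "M > 0" using X_nz M by (metis abs_ge_zero not_less order_le_less_trans zero_less_abs_iff order_less_le_trans)
  have M_eps: "M \<le> \<epsilon>" using X_small M_def by simp
  have a0: "a \<ge> 0" using X_cos by (simp add: a_def)
  have "\<bar>N s\<bar> \<le> K * M^2" for s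
  proof -
    have "\<bar>N s\<bar> \<le> K * (X s)^2" unfolding N_def F_def by (rule f_quadratic[OF X_small])
    also have "\<dots> \<le> K * M^2" using M[of s] K_ge_1 by (intro mult_left_mono) (auto simp: abs_le_square_iff[symmetric])
    finally show ?thesis .
  qed
  hence w: "\<bar>w s\<bar> \<le> 616 * (K * M^2)" for s by (rule w_bound)
  have "616 * (K * M^2) = (616 * K * M) * M" by (simp add: power2_eq_square)
  also have "\<dots> \<le> (1/2) * M"
  proof (rule mult_right_mono)
    \<comment> \<open>The number 1232 = 2 * 616 in \<open>eps_small\<close> is exactly what makes
      this factor at most 1/2.\<close>
    have "616 * K * M \<le> 616 * K * \<epsilon>" using M_eps K_ge_1 by (intro mult_left_mono) auto
    thus "616 * K * M \<le> 1/2" using eps_small by simp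
  qed (use Mpos in simp)
  finally have w': "\<bar>w s\<bar> \<le> M/2" for s using w[of s] by simp
  have "\<bar>X t\<bar> \<le> \<bar>a * cos t\<bar> + \<bar>w t\<bar>" by (simp add: w_def)
  moreover have "\<bar>a * cos t\<bar> \<le> a" by (rule abs_mult_le_bound) (use a0 in auto)
  ultimately have Ma: "M \<le> 2 * a" using w'[of t] M_def by linarith
  show "a > 0" "\<bar>X s\<bar> \<le> 2 * a" using Ma Mpos M[of s] by linarith+
  have "M^2 \<le> (2 * a)^2" using Ma Mpos by (intro power_mono) auto
  hence "K * M^2 \<le> K * (2 * a)^2" using K_ge_1 by (intro mult_left_mono) auto
  thus "\<bar>w s\<bar> \<le> 2464 * K * a^2" using w[of s] by (simp add: power2_eq_square)
qed

section \<open>Expansion of the harmonics in powers of the amplitude\<close>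

lemma a_le: "a \<le> 2 * \<epsilon>"
proof -
  have "\<bar>period_int (\<lambda>s. X s * cos s)\<bar> \<le> 2 * pi * \<epsilon>"
    by (intro period_int_bound abs_mult_le_bound X_small orbit_periodic; simp)
  thus ?thesis by (simp add: a_def pos_divide_le_eq mult_ac)
qed

text \<open>The summand 1 in \<open>K\<close> lets lower powers be absorbed into K^3, so each error
  has a single coefficient.\<close>

lemma K_powers: "K \<le> K^3" "K^2 \<le> K^3"
  using K_ge_1 power_increasing[of 1 3 K] power_increasing[of 2 3 K] by simp_all

lemma a_powers:
  "a^3 \<le> 2 * \<epsilon> * a^2" "a^4 \<le> 2 * \<epsilon> * a^3" "a^3 \<le> a^2" "a^4 \<le> a^3" "0 < a^2" "0 < a^3"
proof -
  note a = amplitude(1) a_le eps_bounds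
  show "a^3 \<le> 2 * \<epsilon> * a^2" "a^4 \<le> 2 * \<epsilon> * a^3"
    using mult_right_mono[OF a_le, of "a^2"] mult_right_mono[OF a_le, of "a^3"] a
    by (simp_all add: power_numeral_reduce)
  have "a \<le> 1" using a by linarith
  thus "a^3 \<le> a^2" "a^4 \<le> a^3" using a by (auto intro!: power_decreasing)
  show "0 < a^2" "0 < a^3" using a by simp_all
qed

lemma abs_B_C: "\<bar>B\<bar> \<le> K" "\<bar>C\<bar> \<le> K" using e_pos by (simp_all add: K_def)

lemma X_expand: "X s = a * cos s + w s" by (simp add: w_def)

text \<open>Replacing X^2 by (a cos)^2 leaves a cross term and w^2, both O(a^3) because w =
  O(a^2).\<close>

lemma F_quadratic:
  "\<bar>F s - X s - B * a^2 * (cos s)^2\<bar> \<le> (K * 8 + K * (2 * (2464 * K) + (2464 * K)^2)) * a^3"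
proof -
  let ?L = "2464 * K"
  have "\<bar>X s\<bar>^3 \<le> (2 * a)^3" by (intro power_mono amplitude) simp
  hence "K * \<bar>X s\<bar>^3 \<le> K * (8 * a^3)" using K_ge_1 by (intro mult_left_mono) (auto simp: power_mult_distrib)
  with f_quadratic(2)[OF X_small, of s]
  have 1: "\<bar>F s - X s - B * (X s)^2\<bar> \<le> K * 8 * a^3" by (simp add: F_def)
  have w: "\<bar>w s\<bar> \<le> ?L * a^2" by (rule amplitude)
  have "\<bar>2 * a * w s\<bar> \<le> 2 * a * (?L * a^2)"
    using w amplitude(1) by (simp add: abs_mult)
  hence "\<bar>(2 * a * w s) * cos s\<bar> \<le> 2 * a * (?L * a^2)"
    by (rule abs_mult_le_bound) simp
  hence 2: "\<bar>(2 * a * w s) * cos s\<bar> \<le> 2 * ?L * a^3"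
    by (simp add: power_numeral_reduce mult_ac)
  have "\<bar>w s\<bar>^2 \<le> (?L * a^2)^2" using w by (intro power_mono) auto
  also have "\<dots> = ?L^2 * a^4" by (simp add: power_mult_distrib)
  also have "\<dots> \<le> ?L^2 * a^3" by (intro mult_left_mono a_powers) simp
  finally have 3: "\<bar>(w s)^2\<bar> \<le> ?L^2 * a^3" by simp
  have eq: "(X s)^2 - a^2 * (cos s)^2 = (2 * a * w s) * cos s + (w s)^2"
    using X_expand[of s] by algebra
  have "\<bar>(X s)^2 - a^2 * (cos s)^2\<bar> \<le> (2 * ?L + ?L^2) * a^3"
    unfolding eq distrib_right using 2 3 by linarith
  hence "\<bar>B * ((X s)^2 - a^2 * (cos s)^2)\<bar> \<le> K * ((2 * ?L + ?L^2) * a^3)"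
    unfolding abs_mult using K_ge_1 abs_B_C by (intro mult_mono) auto
  moreover have "F s - X s - B * a^2 * (cos s)^2 = (F s - X s - B * (X s)^2) + B * ((X s)^2 - a^2 * (cos s)^2)"
    by (simp add: algebra_simps)
  ultimately show ?thesis using 1 by (simp add: distrib_right mult.assoc)
qed

text \<open>Used with the weights 1, cos 2s and sin 2s, it links the coefficients of
  \<open>F\<close> to those of \<open>X\<close>; the balance laws then determine the latter.\<close>

lemma weighted_average:
  assumes "cont_periodic \<phi>" "\<And>s. \<bar>\<phi> s\<bar> \<le> 1"
  shows "\<bar>period_int (\<lambda>s. F s * \<phi> s) - period_int (\<lambda>s. X s * \<phi> s) - B * a^2 * period_int (\<lambda>s. (cos s)^2 * \<phi> s)\<bar>
     \<le> 5 * 10^7 * K^3 * a^3"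
proof -
  have "period_int (\<lambda>s. (F s - X s - B * a^2 * (cos s)^2) * \<phi> s) =
      period_int (\<lambda>s. F s * \<phi> s - X s * \<phi> s - (B * a^2) * ((cos s)^2 * \<phi> s))"
    by (rule arg_cong[of _ _ period_int]) (simp add: fun_eq_iff algebra_simps)
  also have "\<dots> = period_int (\<lambda>s. F s * \<phi> s - X s * \<phi> s) - B * a^2 * period_int (\<lambda>s. (cos s)^2 * \<phi> s)"
    by (subst period_int_diff) (simp_all only: period_int_cmult orbit_periodic assms(1))
  also have "period_int (\<lambda>s. F s * \<phi> s - X s * \<phi> s) = period_int (\<lambda>s. F s * \<phi> s) - period_int (\<lambda>s. X s * \<phi> s)"
    by (intro period_int_diff orbit_periodic assms(1))
  finally have eq: "period_int (\<lambda>s. F s * \<phi> s) - period_int (\<lambda>s. X s * \<phi> s) - B * a^2 * period_int (\<lambda>s. (cos s)^2 * \<phi> s)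
      = period_int (\<lambda>s. (F s - X s - B * a^2 * (cos s)^2) * \<phi> s)" by simp
  let ?c = "K * 8 + K * (2 * (2464 * K) + (2464 * K)^2)"
  have "\<bar>period_int (\<lambda>s. (F s - X s - B * a^2 * (cos s)^2) * \<phi> s)\<bar> \<le> 7 * (?c * a^3)"
    by (intro period_int_bound_7 abs_mult_le_bound F_quadratic assms orbit_periodic)
  also have "\<dots> = (7 * ?c) * a^3" by simp
  also have "\<dots> \<le> 5 * 10^7 * K^3 * a^3"
  proof (rule mult_right_mono)
    \<comment> \<open>The leading coefficient is 7 * 2464^2; rounding up to 5 * 10^7 leaves room for
      the other two terms.\<close>
    have "7 * ?c = 56 * K + 34496 * K^2 + 42499072 * K^3"
      by (simp add: power_numeral_reduce algebra_simps)
    thus "7 * ?c \<le> 5 * 10^7 * K^3" using K_powers K_ge_1 by simp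
  qed (use a_powers in simp)
  finally show ?thesis unfolding eq .
qed

lemma mean_expansion: "\<bar>period_int X + B * pi * a^2\<bar> \<le> 10^8 * K^3 * \<epsilon> * a^2"
proof -
  have "\<bar>period_int F - period_int X - B * a^2 * pi\<bar> \<le> 5 * 10^7 * K^3 * a^3"
    using weighted_average[of "\<lambda>_. 1"] by (simp add: cont_periodic_const period_int_trig)
  also have "\<dots> \<le> 5 * 10^7 * K^3 * (2 * \<epsilon> * a^2)" using K_ge_1 by (intro mult_left_mono a_powers) auto
  finally show ?thesis unfolding harmonic_0 by (simp add: abs_le_iff algebra_simps)
qed

text \<open>With b = B * pi/2 * a^2 the leading relations are Fc = P + b, Fs = Q, 2*P = -Fs and 2*Q
  = Fc. Eliminating gives 5*P = -b, which is the origin of the factor 1/10.\<close>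

lemma second_harmonic_expansion:
  "\<bar>period_int (\<lambda>s. X s * cos (2 * s)) + B * pi / 10 * a^2\<bar> \<le> 35 * 10^7 * K^3 * \<epsilon> * a^2"
proof -
  define P Q Fc Fs where "P = period_int (\<lambda>s. X s * cos (2 * s))" and "Q = period_int (\<lambda>s. X s * sin (2 * s))"
    and "Fc = period_int (\<lambda>s. F s * cos (2 * s))" and "Fs = period_int (\<lambda>s. F s * sin (2 * s))"
  \<comment> \<open>For weights orthogonal to cos only \<open>w\<close> contributes. This crude
    O(a^2) bound on \<open>P\<close> and \<open>Q\<close>, and through them on \<open>Fc\<close> and
    \<open>Fs\<close>, makes the errors from lam and \<theta> of size \<epsilon> * a^2.\<close>
  have Jw: "period_int (\<lambda>s. X s * \<phi> s) = period_int (\<lambda>s. w s * \<phi> s)"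
    if "cont_periodic \<phi>" "period_int (\<lambda>s. cos s * \<phi> s) = 0" for \<phi>
  proof -
    have "period_int (\<lambda>s. X s * \<phi> s) = period_int (\<lambda>s. a * (cos s * \<phi> s) + w s * \<phi> s)"
      by (rule arg_cong[of _ _ period_int]) (simp add: fun_eq_iff w_def algebra_simps)
    also have "\<dots> = a * period_int (\<lambda>s. cos s * \<phi> s) + period_int (\<lambda>s. w s * \<phi> s)"
      by (subst period_int_add) (simp_all only: period_int_cmult orbit_periodic that(1))
    finally show ?thesis using that by simp
  qed
  have Jb: "\<bar>period_int (\<lambda>s. X s * \<phi> s)\<bar> \<le> 7 * (2464 * K * a^2)"
    if "cont_periodic \<phi>" "period_int (\<lambda>s. cos s * \<phi> s) = 0" "\<And>s. \<bar>\<phi> s\<bar> \<le> 1" for \<phi>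
    unfolding Jw[OF that(1,2)] by (intro period_int_bound_7 abs_mult_le_bound amplitude cont_periodic_mult cont_periodic_w that)
  have "\<bar>P\<bar> \<le> 7 * (2464 * K * a^2)" "\<bar>Q\<bar> \<le> 7 * (2464 * K * a^2)"
    unfolding P_def Q_def by (rule Jb; simp add: period_int_trig orbit_periodic)+
  hence PQ: "\<bar>P\<bar> \<le> 17248 * K * a^2" "\<bar>Q\<bar> \<le> 17248 * K * a^2" by simp_all
  have Fc: "\<bar>Fc - P - B * pi / 2 * a^2\<bar> \<le> 5 * 10^7 * K^3 * a^3"
    using weighted_average[OF cont_periodic_cos2 abs_cos_le_one, unfolded period_int_trig] by (simp add: Fc_def P_def mult_ac)
  have Fs: "\<bar>Fs - Q\<bar> \<le> 5 * 10^7 * K^3 * a^3"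
    using weighted_average[OF cont_periodic_sin2 abs_sin_le_one, unfolded period_int_trig] by (simp add: Fs_def Q_def)
  define k u v b where "k = K^3 * a^2" and "u = K * a^2" and "v = K^3 * a^3" and "b = B * pi / 2 * a^2"
  have k0: "k \<ge> 0" using K_ge_1 by (simp add: k_def)
  have "u \<le> k" unfolding k_def u_def by (intro mult_right_mono K_powers) simp
  moreover have "\<bar>b\<bar> \<le> 4 * u"
  proof -
    have "\<bar>B * (pi / 2)\<bar> \<le> K * 4"
      unfolding abs_mult using abs_B_C K_ge_1 pi_less_4 by (intro mult_mono) auto
    hence "\<bar>B * (pi / 2)\<bar> * a^2 \<le> K * 4 * a^2" by (rule mult_right_mono) simp
    thus ?thesis by (simp add: abs_mult b_def u_def)
  qed
  moreover have "v \<le> k" unfolding k_def v_def using K_ge_1 by (intro mult_left_mono a_powers) auto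
  moreover have "\<bar>P\<bar> \<le> 17248 * u" "\<bar>Q\<bar> \<le> 17248 * u" using PQ by (simp_all add: u_def)
  moreover have Fcv: "\<bar>Fc - P - b\<bar> \<le> 50000000 * v" and Fsv: "\<bar>Fs - Q\<bar> \<le> 50000000 * v"
    using Fc Fs by (simp_all add: v_def b_def)
  ultimately have FcFs: "\<bar>Fc\<bar> \<le> 60000000 * k" "\<bar>Fs\<bar> \<le> 60000000 * k"
    using k0 by linarith+
  have c: "\<bar>lam * cos (2 * \<theta>) - 1\<bar> \<le> 4 * \<epsilon>"
  proof -
    have "\<bar>1 - cos (2 * \<theta>)\<bar> = 2 * (\<bar>sin \<theta>\<bar> * \<bar>sin \<theta>\<bar>)"
      by (simp add: cos_double_sin power2_eq_square)
    also have "\<bar>sin \<theta>\<bar> * \<bar>sin \<theta>\<bar> \<le> \<bar>\<theta>\<bar> * 1"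
      by (intro mult_mono abs_sin_x_le_abs_x) auto
    finally have "\<bar>1 - cos (2 * \<theta>)\<bar> \<le> 2 * \<epsilon>" using theta_near by simp
    moreover have "\<bar>(lam - 1) * cos (2 * \<theta>)\<bar> \<le> \<epsilon>"
      by (intro abs_mult_le_bound lam_near) simp
    ultimately show ?thesis using eps_bounds(1) unfolding left_diff_distrib mult_1 by linarith
  qed
  have s: "\<bar>lam * sin (2 * \<theta>)\<bar> \<le> 4 * \<epsilon>"
  proof -
    have "\<bar>sin (2 * \<theta>)\<bar> \<le> 2 * \<epsilon>" using abs_sin_x_le_abs_x[of "2 * \<theta>"] theta_near by simp
    hence "\<bar>lam * sin (2 * \<theta>)\<bar> \<le> 2 * (2 * \<epsilon>)"
      unfolding abs_mult using lam_bounds by (intro mult_mono) auto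
    thus ?thesis by simp
  qed
  define m where "m = \<epsilon> * k"
  have pm: "\<bar>x * y\<bar> \<le> 240000000 * m" if "\<bar>x\<bar> \<le> 4 * \<epsilon>" "\<bar>y\<bar> \<le> 60000000 * k" for x y
    using mult_mono[OF that] eps_bounds by (simp add: abs_mult m_def mult_ac)
  have "2 * Q - Fc = (lam * cos (2 * \<theta>) - 1) * Fc - (lam * sin (2 * \<theta>)) * Fs"
    using harmonic_2(2) unfolding P_def Q_def Fc_def Fs_def by (simp add: algebra_simps)
  hence 1: "\<bar>2 * Q - Fc\<bar> \<le> 480000000 * m" using pm[OF c FcFs(1)] pm[OF s FcFs(2)] by linarith
  have "2 * P + Fs = - ((lam * cos (2 * \<theta>) - 1) * Fs) - (lam * sin (2 * \<theta>)) * Fc"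
    using harmonic_2(1) unfolding P_def Q_def Fc_def Fs_def by (simp add: algebra_simps)
  hence 2: "\<bar>2 * P + Fs\<bar> \<le> 480000000 * m" using pm[OF c FcFs(2)] pm[OF s FcFs(1)] by linarith
  have "v \<le> K^3 * (2 * \<epsilon> * a^2)"
    unfolding v_def using K_ge_1 by (intro mult_left_mono a_powers) auto
  hence "v \<le> 2 * m" by (simp add: m_def k_def mult_ac)
  \<comment> \<open>The combination is 5P + b = 2(2P + Fs) - (2Q - Fc) - 2(Fs - Q) - (Fc - P -
    b).\<close>
  hence "\<bar>5 * P + b\<bar> \<le> 1740000000 * m" using 1 2 Fcv Fsv by linarith
  moreover have "m \<ge> 0" using eps_bounds k0 by (simp add: m_def)
  ultimately have "\<bar>P + b / 5\<bar> \<le> 350000000 * m" by linarith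
  thus ?thesis by (simp add: P_def b_def m_def k_def mult_ac)
qed

text \<open>The term linear in \<open>w\<close> is 2*a*w*cos^2 = a*w*(1 + cos 2s), so exactly the
  mean and the second cosine harmonic of \<open>w\<close> are needed. They contribute 1 and 1/10 to
  the factor 11/10.\<close>

lemma square_expansion:
  "\<bar>period_int (\<lambda>s. (X s)^2 * cos s) + 11 * pi / 10 * B * a^3\<bar> \<le> 6 * 10^8 * K^3 * \<epsilon> * a^3"
proof -
  \<comment> \<open>Written with \<open>X\<close> in place of \<open>w\<close> so that the two
    expansions apply directly; the compensating terms in cos s and cos s * cos 2s have zero
    integral.\<close>
  have eq: "(X s)^2 * cos s = a^2 * (cos s)^3 + (a * (X s) + (a * (X s * cos (2 * s)) +
      ((w s)^2 * cos s - a^2 * (cos s + cos s * cos (2 * s)))))" for s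
    using X_expand[of s] cos_double_cos[of s] by algebra
  define P where "P = period_int (\<lambda>s. X s * cos (2 * s))"
  have total: "period_int (\<lambda>s. (X s)^2 * cos s) = a * period_int X + a * P + period_int (\<lambda>s. (w s)^2 * cos s)"
    unfolding eq P_def by (simp add: period_int_add period_int_diff period_int_cmult period_int_trig orbit_periodic)
  define y z where "y = pi * B * a^3" and "z = K^3 * \<epsilon> * a^3"
  have z0: "0 \<le> z" using K_ge_1 eps_bounds amplitude(1) by (simp add: z_def)
  have remainder: "\<bar>period_int (\<lambda>s. (w s)^2 * cos s)\<bar> \<le> 100000000 * z"
  proof -
    have "\<bar>w s\<bar>^2 \<le> (2464 * K * a^2)^2" for s by (intro power_mono amplitude) simp
    hence "\<bar>period_int (\<lambda>s. (w s)^2 * cos s)\<bar> \<le> 7 * (2464 * K * a^2)^2"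
      by (intro period_int_bound_7 abs_mult_le_bound orbit_periodic) auto
    also have "\<dots> = (7 * 2464^2 * K^2) * a^4" by (simp add: power_mult_distrib)
    also have "\<dots> \<le> (7 * 2464^2 * K^3) * (2 * \<epsilon> * a^3)"
      using a_powers K_powers K_ge_1 amplitude(1) by (intro mult_mono) auto
    also have "\<dots> = 84998144 * (K^3 * \<epsilon> * a^3)" by simp
    also have "\<dots> \<le> 10^8 * (K^3 * \<epsilon> * a^3)"
      using K_ge_1 eps_bounds amplitude(1) by (intro mult_right_mono) auto
    finally show ?thesis by (simp add: z_def)
  qed
  have "\<bar>a * (period_int X + B * pi * a^2)\<bar> \<le> a * (10^8 * K^3 * \<epsilon> * a^2)"
    using mean_expansion amplitude(1) by (simp add: abs_mult)
  also have "a * (period_int X + B * pi * a^2) = a * period_int X + y"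
    by (simp add: y_def power_numeral_reduce distrib_left mult_ac)
  also have "a * (10^8 * K^3 * \<epsilon> * a^2) = 100000000 * z"
    by (simp add: z_def power_numeral_reduce mult_ac)
  finally have mean: "\<bar>a * period_int X + y\<bar> \<le> 100000000 * z" .
  have "\<bar>a * (P + B * pi / 10 * a^2)\<bar> \<le> a * (35 * 10^7 * K^3 * \<epsilon> * a^2)"
    using second_harmonic_expansion amplitude(1) by (simp add: abs_mult P_def)
  also have "a * (P + B * pi / 10 * a^2) = a * P + y / 10"
    by (simp add: y_def power_numeral_reduce distrib_left mult_ac)
  also have "a * (35 * 10^7 * K^3 * \<epsilon> * a^2) = 350000000 * z"
    by (simp add: z_def power_numeral_reduce mult_ac)
  finally have second: "\<bar>a * P + y / 10\<bar> \<le> 350000000 * z" .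
  have "\<bar>period_int (\<lambda>s. (X s)^2 * cos s) + 11 / 10 * y\<bar> \<le> 600000000 * z"
    unfolding total using z0 remainder mean second by linarith
  thus ?thesis by (simp add: y_def z_def mult_ac)
qed

text \<open>The difference X^3 - (a cos)^3 has the factor w = O(a^2), so only the integral 3*pi/4 of
  cos^4 survives at order a^3.\<close>

lemma cube_expansion:
  "\<bar>period_int (\<lambda>s. (X s)^3 * cos s) - 3 * pi / 4 * a^3\<bar> \<le> 10^6 * K^3 * \<epsilon> * a^3"
proof -
  define q where "q s = w s * ((X s)^2 + (X s * (a * cos s)) + (a * cos s)^2)" for s
  have pq: "cont_periodic q" unfolding q_def by (intro orbit_periodic)
  have eq: "(X s)^3 * cos s = a^3 * (cos s)^4 + q s * cos s" for s
    using X_expand[of s] q_def[of s] by algebra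
  have Jq: "period_int (\<lambda>s. (X s)^3 * cos s) = 3 * pi / 4 * a^3 + period_int (\<lambda>s. q s * cos s)"
    unfolding eq by (simp add: period_int_add period_int_cmult period_int_trig orbit_periodic pq)
  have "\<bar>period_int (\<lambda>s. q s * cos s)\<bar> \<le> 7 * (2464 * K * a^2 * (7 * a^2))"
  proof (intro period_int_bound_7 abs_mult_le_bound orbit_periodic pq)
    fix s
    have ac: "\<bar>a * cos s\<bar> \<le> a" using amplitude(1) by (intro abs_mult_le_bound) auto
    have 1: "(X s)^2 \<le> 4 * a^2" "(a * cos s)^2 \<le> a^2"
      using abs_le_square_iff[of "X s" "2 * a"] abs_le_square_iff[of "a * cos s" a]
        amplitude(1) amplitude(2)[of s] ac by (simp_all add: power_mult_distrib[of 2 a])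
    have 2: "\<bar>X s * (a * cos s)\<bar> \<le> 2 * a^2"
      using mult_mono[OF amplitude(2)[of s] ac] amplitude(1)
      unfolding abs_mult[of "X s"] by (simp add: power2_eq_square)
    have 3: "0 \<le> (X s)^2" "0 \<le> (a * cos s)^2" by simp_all
    hence "\<bar>(X s)^2 + (X s * (a * cos s)) + (a * cos s)^2\<bar> \<le> 7 * a^2"
      using 1 2 3 by linarith
    thus "\<bar>q s\<bar> \<le> 2464 * K * a^2 * (7 * a^2)"
      unfolding q_def abs_mult using amplitude(3)[of s] K_ge_1 by (intro mult_mono) auto
  qed simp
  also have "7 * (2464 * K * a^2 * (7 * a^2)) = 120736 * K * a^4"
    by (simp add: power_numeral_reduce)
  also have "\<dots> \<le> 120736 * K^3 * (2 * \<epsilon> * a^3)"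
    using a_powers K_powers K_ge_1 amplitude(1) by (intro mult_mono) auto
  also have "\<dots> = 241472 * (K^3 * \<epsilon> * a^3)" by simp
  also have "\<dots> \<le> 10^6 * (K^3 * \<epsilon> * a^3)"
    using K_ge_1 eps_bounds amplitude(1) by (intro mult_right_mono) auto
  finally show ?thesis unfolding Jq by simp
qed

text \<open>The first harmonic of \<open>N\<close> is the cubic Taylor polynomial tested against
  cos. The factors |B| and |C| raise K^3 to K^4, and 56 = 7 * 8 is the period bound times the cube
  of |X| \<le> 2*a.\<close>

lemma first_harmonic_gain:
  "a^3 * (pi * (3 * C / 4 - 11 * B^2 / 10) - 10^9 * K^4 * \<epsilon> - 56 * e) \<le> pi * (\<alpha> - a)"
proof -
  define R where "R s = F s - X s - B * (X s)^2 - C * (X s)^3" for s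
  have pR: "cont_periodic R" unfolding R_def by (intro orbit_periodic)
  define X2 X3 where "X2 = period_int (\<lambda>s. (X s)^2 * cos s)" and "X3 = period_int (\<lambda>s. (X s)^3 * cos s)"
  have eq: "N s * cos s = R s * cos s + (B * ((X s)^2 * cos s) + C * ((X s)^3 * cos s))" for s
    unfolding R_def N_def by (simp add: algebra_simps)
  have total: "pi * (\<alpha> - a) = period_int (\<lambda>s. R s * cos s) + (B * X2 + C * X3)"
    unfolding harmonic_1_N eq X2_def X3_def by (simp add: period_int_add period_int_cmult orbit_periodic pR)
  have remainder: "\<bar>period_int (\<lambda>s. R s * cos s)\<bar> \<le> 7 * (e * (8 * a^3))"
  proof (intro period_int_bound_7 abs_mult_le_bound orbit_periodic pR)
    fix s
    have "\<bar>R s\<bar> \<le> e * \<bar>X s\<bar>^3" unfolding R_def F_def by (rule taylor[OF X_small])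
    also have "\<dots> \<le> e * (2 * a)^3" using e_pos by (intro mult_left_mono power_mono amplitude) auto
    finally show "\<bar>R s\<bar> \<le> e * (8 * a^3)" by (simp add: power_mult_distrib)
  qed simp
  define y x z where "y = pi * (B^2 * a^3)" and "x = pi * (C * a^3)" and "z = K^4 * \<epsilon> * a^3"
  have z0: "0 \<le> z" using K_ge_1 eps_bounds amplitude(1) by (simp add: z_def)
  have "\<bar>B * (X2 + 11 * pi / 10 * B * a^3)\<bar> \<le> K * (6 * 10^8 * K^3 * \<epsilon> * a^3)"
    unfolding abs_mult[of B] X2_def using abs_B_C square_expansion K_ge_1 by (intro mult_mono) auto
  also have "B * (X2 + 11 * pi / 10 * B * a^3) = B * X2 + 11 / 10 * y"
    by (simp add: y_def power2_eq_square distrib_left mult_ac)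
  also have "K * (6 * 10^8 * K^3 * \<epsilon> * a^3) = 600000000 * z"
    by (simp add: z_def power_numeral_reduce)
  finally have B2: "\<bar>B * X2 + 11 / 10 * y\<bar> \<le> 600000000 * z" .
  have "\<bar>C * (X3 - 3 * pi / 4 * a^3)\<bar> \<le> K * (10^6 * K^3 * \<epsilon> * a^3)"
    unfolding abs_mult[of C] X3_def using abs_B_C cube_expansion K_ge_1 by (intro mult_mono) auto
  also have "C * (X3 - 3 * pi / 4 * a^3) = C * X3 - 3 / 4 * x"
    by (simp add: x_def right_diff_distrib mult_ac)
  also have "K * (10^6 * K^3 * \<epsilon> * a^3) = 1000000 * z"
    by (simp add: z_def power_numeral_reduce)
  finally have C3: "\<bar>C * X3 - 3 / 4 * x\<bar> \<le> 1000000 * z" .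
  have "a^3 * (pi * (3 * C / 4 - 11 * B^2 / 10) - 10^9 * K^4 * \<epsilon> - 56 * e)
      = 3 / 4 * x - 11 / 10 * y - 1000000000 * z - 7 * (e * (8 * a^3))"
    by (simp add: y_def x_def z_def right_diff_distrib mult_ac)
  also have "\<dots> \<le> pi * (\<alpha> - a)"
    unfolding total using z0 B2 C3 remainder by linarith
  finally show ?thesis .
qed

lemma frequency_ratio:
  assumes "10^9 * K^4 * \<epsilon> + 56 * e \<le> pi * (3 * C / 4 - 11 * B^2 / 10)"
  shows "lam \<le> 1"
proof -
  have "0 \<le> a^3 * (pi * (3 * C / 4 - 11 * B^2 / 10) - 10^9 * K^4 * \<epsilon> - 56 * e)"
    using assms a_powers by (intro mult_nonneg_nonneg) auto
  with first_harmonic_gain have "0 \<le> pi * (\<alpha> - a)" by linarith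
  hence "a \<le> \<alpha>" using mult_le_cancel_left_pos[of pi a \<alpha>] by (simp add: right_diff_distrib)
  hence "lam * a \<le> lam * \<alpha>" using lam_bounds by (intro mult_left_mono) auto
  also have "\<dots> = a * cos \<theta>" by (rule harmonic_1)
  also have "\<dots> \<le> a * 1" using amplitude(1) by (intro mult_left_mono) auto
  finally show ?thesis using amplitude(1) by (simp add: mult.commute)
qed

end

subsection \<open>Transfer to the delay equation\<close>

text \<open>The Lagrange remainder of order three has the third derivative at an intermediate point;
  its continuity at 0 lets that point be replaced by 0. Halving the radius yields the strict
  inequality needed there.\<close>

lemma C3_taylor:
  assumes f: "C3 f" "f 0 = 0" "deriv f 0 = 1" and e: "e > 0"
  shows "\<exists>r>0. \<forall>x. \<bar>x\<bar> \<le> r \<longrightarrow>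
    \<bar>f x - x - deriv (deriv f) 0 / 2 * x^2 - deriv (deriv (deriv f)) 0 / 6 * x^3\<bar> \<le> e * \<bar>x\<bar>^3"
proof -
  let ?D = "deriv (deriv (deriv f))"
  have "isCont ?D 0" using f(1) by (simp add: C3_def continuous_on_eq_continuous_at)
  then obtain r where r: "r > 0" "\<And>t. \<bar>t\<bar> < r \<Longrightarrow> \<bar>?D t - ?D 0\<bar> < 6 * e"
    using e unfolding continuous_at_eps_delta by (metis diff_zero dist_real_def mult_pos_pos zero_less_numeral)
  have "\<bar>f x - x - deriv (deriv f) 0 / 2 * x^2 - ?D 0 / 6 * x^3\<bar> \<le> e * \<bar>x\<bar>^3" if x: "\<bar>x\<bar> \<le> r/2" for x
  proof -
    have "\<exists>t. \<bar>t\<bar> \<le> \<bar>x\<bar> \<and> f x = (\<Sum>m<3. (deriv ^^ m) f 0 / fact m * x ^ m) + (deriv ^^ 3) f t / fact 3 * x ^ 3"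
    proof (rule Maclaurin_bi_le)
      have "((deriv ^^ m) f has_real_derivative (deriv ^^ Suc m) f t) (at t)" if "m < 3" for m t
      proof -
        from that consider "m = 0" | "m = 1" | "m = 2" by linarith
        then show ?thesis
          using f(1) by cases (auto simp: C3_def DERIV_deriv_iff_real_differentiable numeral_2_eq_2)
      qed
      thus "\<forall>m t. m < 3 \<and> \<bar>t\<bar> \<le> \<bar>x\<bar> \<longrightarrow> ((deriv ^^ m) f has_real_derivative (deriv ^^ Suc m) f t) (at t)"
        by blast
    qed simp
    then obtain t where t: "\<bar>t\<bar> \<le> \<bar>x\<bar>" "f x = x + deriv (deriv f) 0 / 2 * x^2 + ?D t / 6 * x^3"
      using f by (auto simp: numeral_3_eq_3 numeral_2_eq_2 eval_nat_numeral)
    have "f x - x - deriv (deriv f) 0 / 2 * x^2 - ?D 0 / 6 * x^3 = (?D t - ?D 0) / 6 * x^3"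
      unfolding t(2) by (simp add: field_simps)
    also have "\<bar>\<dots>\<bar> \<le> e * \<bar>x\<bar>^3"
      unfolding abs_mult power_abs using r(2)[of t] t(1) x r(1) by (intro mult_right_mono) auto
    finally show ?thesis .
  qed
  with r(1) show ?thesis by (intro exI[of _ "r/2"]) auto
qed

text \<open>Time translation rotates the pair of first-order coefficients as a complex number;
  shifting by its argument puts it on the nonnegative real axis.\<close>

lemma phase_normalization:
  assumes Y: "cont_periodic Y"
  obtains c where "period_int (\<lambda>s. Y (s + c) * sin s) = 0" "period_int (\<lambda>s. Y (s + c) * cos s) \<ge> 0"
proof -
  define p q where "p = period_int (\<lambda>s. Y s * cos s)" and "q = period_int (\<lambda>s. Y s * sin s)"
  define c where "c = Arg (Complex p q)"
  define r where "r = cmod (Complex p q)"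
  have "Complex p q = rcis r c" unfolding r_def c_def by (rule rcis_cmod_Arg[symmetric])
  hence pq: "p = r * cos c" "q = r * sin c" by (simp_all add: complex_eq_iff)
  have 1: "period_int (\<lambda>s. Y (s + c) * \<phi> s) = period_int (\<lambda>s. Y s * \<phi> (s - c))" if "cont_periodic \<phi>" for \<phi>
    using period_int_shift[of "\<lambda>s. Y s * \<phi> (s - c)" c] by (simp add: cont_periodic_intros Y that)
  have "period_int (\<lambda>s. Y (s + c) * sin s) = period_int (\<lambda>s. cos c * (Y s * sin s) - sin c * (Y s * cos s))"
    unfolding 1[OF cont_periodic_sin] by (rule arg_cong[of _ _ period_int]) (simp add: fun_eq_iff sin_diff algebra_simps)
  also have "\<dots> = cos c * q - sin c * p"
    unfolding p_def q_def by (subst period_int_diff) (simp_all only: period_int_cmult cont_periodic_intros Y)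
  finally have s: "period_int (\<lambda>s. Y (s + c) * sin s) = 0" by (simp add: pq)
  have "period_int (\<lambda>s. Y (s + c) * cos s) = period_int (\<lambda>s. cos c * (Y s * cos s) + sin c * (Y s * sin s))"
    unfolding 1[OF cont_periodic_cos] by (rule arg_cong[of _ _ period_int]) (simp add: fun_eq_iff cos_diff algebra_simps)
  also have "\<dots> = cos c * p + sin c * q"
    unfolding p_def q_def by (subst period_int_add) (simp_all only: period_int_cmult cont_periodic_intros Y)
  also have "\<dots> = r * ((sin c)^2 + (cos c)^2)" unfolding pq by algebra
  finally have "period_int (\<lambda>s. Y (s + c) * cos s) \<ge> 0" by (simp add: r_def)
  with s show ?thesis by (rule that)
qed

lemma small_orbit_frequency:
  fixes f x :: "real \<Rightarrow> real" and k :: int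
  assumes cont: "continuous_on UNIV f"
    and sol: "dde_solution f \<mu> x"
    and period: "\<And>t. x (t + 2 * pi / \<omega>) = x t" and \<omega>: "\<omega> > 0"
    and nonconst: "x s0 \<noteq> x t0"
    and near: "\<bar>\<mu> / \<omega> - 1\<bar> \<le> \<epsilon>" "\<bar>\<omega> - muk k\<bar> \<le> \<epsilon>" "\<And>t. \<bar>x t\<bar> \<le> \<epsilon>"
    and taylor: "\<And>x. \<bar>x\<bar> \<le> \<epsilon> \<Longrightarrow> \<bar>f x - x - B * x^2 - C * x^3\<bar> \<le> e * \<bar>x\<bar>^3"
    and e: "e > 0"
    and K: "K = \<bar>B\<bar> + \<bar>C\<bar> + e + 1" "1232 * K * \<epsilon> \<le> 1"
    and gain: "10^9 * K^4 * \<epsilon> + 56 * e \<le> pi * (3 * C / 4 - 11 * B^2 / 10)"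
  shows "\<mu> \<le> \<omega>"
proof -
  define Y where "Y s = x (s / \<omega>)" for s
  have dx: "(x has_real_derivative - \<mu> * f (x (t - 1))) (at t)" for t
    using sol by (simp add: dde_solution_def)
  have dY: "(Y has_real_derivative - (\<mu> / \<omega>) * f (Y (s - \<omega>))) (at s)" for s
  proof -
    have "((\<lambda>s. x (s / \<omega>)) has_real_derivative (- \<mu> * f (x (s / \<omega> - 1))) * (1 / \<omega>)) (at s)"
      by (rule DERIV_chain2[where f = x, OF dx]) (use \<omega> in \<open>auto intro!: derivative_eq_intros\<close>)
    moreover have "(s - \<omega>) / \<omega> = s / \<omega> - 1" using \<omega> by (simp add: field_simps)
    ultimately show ?thesis unfolding Y_def[abs_def] by simp
  qed
  have Y: "cont_periodic Y"
  proof -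
    have "continuous_on UNIV Y"
      using dY by (meson DERIV_isCont continuous_at_imp_continuous_on)
    moreover have "Y (s + 2 * pi) = Y s" for s
      using period[of "s / \<omega>"] by (simp add: Y_def add_divide_distrib)
    ultimately show ?thesis by (simp add: cont_periodic_def)
  qed
  obtain c where c: "period_int (\<lambda>s. Y (s + c) * sin s) = 0" "period_int (\<lambda>s. Y (s + c) * cos s) \<ge> 0"
    by (rule phase_normalization[OF Y])
  define X where "X s = Y (s + c)" for s
  have "scaled_orbit f X (\<mu> / \<omega>) (\<omega> - muk k) \<epsilon> B C e K"
  proof
    show "cont_periodic X" unfolding X_def by (intro cont_periodic_shift Y)
    show "(X has_real_derivative - (\<mu> / \<omega>) * f (X (s - (pi/2 + (\<omega> - muk k))))) (at s)" for s
    proof -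
      \<comment> \<open>Since \<open>muk k\<close> - pi/2 = 2*pi*k, the two arguments differ by
        \<open>k\<close> full periods.\<close>
      have "X (s - (pi/2 + (\<omega> - muk k))) = Y ((s + c - \<omega>) + of_int k * (2 * pi))"
        unfolding X_def muk_def by (rule arg_cong[of _ _ Y]) (simp add: field_simps)
      also have "\<dots> = Y (s + c - \<omega>)" by (rule cont_periodic_of_int[OF Y])
      finally show ?thesis
        using dY[of "s + c"] DERIV_shift[of Y _ s c] by (simp add: X_def[abs_def])
    qed
    show "\<exists>s. X s \<noteq> 0"
    proof (rule ccontr)
      assume "\<nexists>s. X s \<noteq> 0"
      hence "x t = 0" for t
        using \<omega> X_def[of "\<omega> * t - c"] by (simp add: Y_def)
      thus False using nonconst by simp
    qed
  qed (use cont c near taylor e K in \<open>auto simp: X_def Y_def\<close>)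
  then interpret scaled_orbit f X "\<mu> / \<omega>" "\<omega> - muk k" \<epsilon> B C e K .
  have "\<mu> / \<omega> \<le> 1" by (rule frequency_ratio[OF gain])
  thus ?thesis using \<omega> by simp
qed

theorem theorem3:
  fixes f :: "real \<Rightarrow> real" and k :: nat
    and p :: "real \<Rightarrow> real \<Rightarrow> real" and T :: "real \<Rightarrow> real" and \<eta>k :: real
  assumes f_C3: "C3 f" and f0: "f 0 = 0" and f'0: "deriv f 0 = 1"
    and subcrit: "\<forall>m::int. deriv (deriv (deriv f)) 0 / 6 > Hk m * (deriv (deriv f) 0 / 2)\<^sup>2"
    and \<eta>k_pos: "\<eta>k > 0"
    and branch_sol: "\<forall>\<eta>\<in>{0<..<\<eta>k}. dde_solution f (muk (int k) - \<eta>) (p \<eta>)"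
    and branch_nonconst: "\<forall>\<eta>\<in>{0<..<\<eta>k}. \<exists>s t. p \<eta> s \<noteq> p \<eta> t"
    and branch_period: "\<forall>\<eta>\<in>{0<..<\<eta>k}. minimal_period (p \<eta>) (T \<eta>)"
    and branch_amplitude: "\<forall>\<epsilon>>0. \<forall>\<^sub>F \<eta> in at_right 0. \<forall>t. \<bar>p \<eta> t\<bar> < \<epsilon>"
    and branch_T0: "(T \<longlongrightarrow> 4 / (4 * real k + 1)) (at_right 0)"
    and branch_unique: "\<exists>\<epsilon>>0. \<forall>\<eta>\<in>{0<..<min \<epsilon> \<eta>k}. \<forall>q Tq.
        dde_solution f (muk (int k) - \<eta>) q \<and> minimal_period q Tq
        \<and> (\<forall>t. \<bar>q t\<bar> < \<epsilon>) \<and> \<bar>Tq - 4 / (4 * real k + 1)\<bar> < \<epsilon>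
        \<longrightarrow> (\<exists>c. \<forall>t. q t = p \<eta> (t + c))"
  shows "\<forall>\<^sub>F \<eta> in at_right 0. T \<eta> \<le> 4 / (4 * real k + 1 - 2 * \<eta> / pi)"
proof -
  define B C where "B = deriv (deriv f) 0 / 2" and "C = deriv (deriv (deriv f)) 0 / 6"
  define D where "D = 3 * C / 4 - 11 * B^2 / 10"
  \<comment> \<open>the bifurcation at $m = -1$ gives a threshold above the supremum of $H$ over $m \geq 0$\<close>
  have "22 / 15 \<le> Hk (-1)" by (simp add: Hk_def field_simps)
  hence "22 / 15 * B^2 \<le> Hk (-1) * B^2" by (intro mult_right_mono) auto
  also have "\<dots> < C" using subcrit by (simp add: B_def C_def)
  finally have D: "D > 0" by (simp add: D_def)
  \<comment> \<open>The gain available is pi*D, at least 2*D: the Taylor error 56*e spends one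
    \<open>D\<close>, and the bound on \<open>\<epsilon>\<close> below limits the other error to a
    second \<open>D\<close>.\<close>
  define e where "e = D / 56"
  have e: "e > 0" using D by (simp add: e_def)
  obtain r where r: "r > 0" "\<And>x. \<bar>x\<bar> \<le> r \<Longrightarrow> \<bar>f x - x - B * x^2 - C * x^3\<bar> \<le> e * \<bar>x\<bar>^3"
    using C3_taylor[OF f_C3 f0 f'0 e] unfolding B_def C_def by blast
  define K where "K = \<bar>B\<bar> + \<bar>C\<bar> + e + 1"
  have K: "K \<ge> 1" using e by (simp add: K_def)
  define \<epsilon> where "\<epsilon> = min r (min (1 / (1232 * K)) (D / (10^9 * K^4)))"
  have \<epsilon>: "\<epsilon> > 0" "\<epsilon> \<le> r" "\<epsilon> \<le> 1 / (1232 * K)" "\<epsilon> \<le> D / (10^9 * K^4)"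
    using r(1) K D by (auto simp: \<epsilon>_def)
  have gain: "10^9 * K^4 * \<epsilon> + 56 * e \<le> pi * D"
  proof -
    have "10^9 * K^4 * \<epsilon> \<le> D" using \<epsilon>(4) K by (simp add: field_simps)
    moreover have "2 * D \<le> pi * D" using D pi_ge_two by (intro mult_right_mono) auto
    ultimately show ?thesis by (simp add: e_def)
  qed
  have K\<epsilon>: "1232 * K * \<epsilon> \<le> 1" using \<epsilon>(3) K by (simp add: field_simps)
  have cont: "continuous_on UNIV f"
    using f_C3 by (meson C3_def continuous_at_imp_continuous_on differentiable_imp_continuous_within)
  define \<mu>0 where "\<mu>0 = muk (int k)"
  have \<mu>0: "\<mu>0 > 0" "\<mu>0 = 2 * pi / (4 / (4 * real k + 1))" by (simp_all add: \<mu>0_def muk_def)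
  have lim: "((\<lambda>\<eta>. 2 * pi / T \<eta>) \<longlongrightarrow> \<mu>0) (at_right 0)"
    unfolding \<mu>0(2) by (intro tendsto_intros branch_T0) simp
  \<comment> \<open>Both \<mu> and \<omega> tend to the positive number \<open>\<mu>0\<close>, so
    their ratio tends to 1; this gives the smallness of lam - 1.\<close>
  have "((\<lambda>\<eta>. (\<mu>0 - \<eta>) / (2 * pi / T \<eta>)) \<longlongrightarrow> (\<mu>0 - 0) / \<mu>0) (at_right 0)"
    by (intro tendsto_intros lim) (use \<mu>0(1) in simp)
  hence lim': "((\<lambda>\<eta>. (\<mu>0 - \<eta>) / (2 * pi / T \<eta>)) \<longlongrightarrow> 1) (at_right 0)" using \<mu>0(1) by simp
  \<comment> \<open>Keeping \<eta> below \<open>\<mu>0\<close> makes the parameter positive, as the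
    final division requires.\<close>
  have "\<forall>\<^sub>F \<eta> in at_right 0. \<eta> \<in> {0<..<min \<eta>k \<mu>0}"
    by (rule eventually_at_right_real) (use \<eta>k_pos \<mu>0(1) in simp)
  moreover note tendstoD[OF lim \<epsilon>(1)] tendstoD[OF lim' \<epsilon>(1)] branch_amplitude[rule_format, OF \<epsilon>(1)]
  ultimately show ?thesis
  proof eventually_elim
    case (elim \<eta>)
    from elim(1) have \<eta>: "\<eta> \<in> {0<..<\<eta>k}" "\<eta> < \<mu>0" by auto
    have T: "T \<eta> > 0" "\<And>t. p \<eta> (t + T \<eta>) = p \<eta> t"
      using branch_period \<eta>(1) by (auto simp: minimal_period_def)
    obtain s t where "p \<eta> s \<noteq> p \<eta> t" using branch_nonconst \<eta>(1) by blast
    have "\<mu>0 - \<eta> \<le> 2 * pi / T \<eta>"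
    proof (rule small_orbit_frequency[where \<epsilon> = \<epsilon>])
      show "continuous_on UNIV f" by (rule cont)
      show "dde_solution f (\<mu>0 - \<eta>) (p \<eta>)" using branch_sol \<eta>(1) by (simp add: \<mu>0_def)
      show "p \<eta> (t + 2 * pi / (2 * pi / T \<eta>)) = p \<eta> t" for t using T by simp
      show "p \<eta> s \<noteq> p \<eta> t" by fact
      show "\<bar>2 * pi / T \<eta> - muk (int k)\<bar> \<le> \<epsilon>" using elim(2) by (simp add: dist_real_def \<mu>0_def)
      show "\<bar>(\<mu>0 - \<eta>) / (2 * pi / T \<eta>) - 1\<bar> \<le> \<epsilon>" using elim(3) by (simp add: dist_real_def)
      show "\<bar>p \<eta> t\<bar> \<le> \<epsilon>" for t using elim(4) by (simp add: less_imp_le)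
      show "\<bar>f x - x - B * x^2 - C * x^3\<bar> \<le> e * \<bar>x\<bar>^3" if "\<bar>x\<bar> \<le> \<epsilon>" for x
        using that \<epsilon>(2) by (intro r(2)) simp
      show "10^9 * K^4 * \<epsilon> + 56 * e \<le> pi * (3 * C / 4 - 11 * B^2 / 10)"
        using gain by (simp add: D_def)
    qed (use T e K\<epsilon> K_def in auto)
    hence "T \<eta> \<le> 2 * pi / (\<mu>0 - \<eta>)" using T(1) \<eta>(2) by (simp add: field_simps)
    also have "\<dots> = 4 / (2 * (\<mu>0 - \<eta>) / pi)" using \<eta>(2) by (simp add: field_simps)
    also have "2 * (\<mu>0 - \<eta>) / pi = 4 * real k + 1 - 2 * \<eta> / pi"
      by (simp add: \<mu>0_def muk_def field_simps)
    finally show ?case .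
  qed
qed

end
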